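(* Let $v\in L_2(-\infty,+\infty)$ and $\alpha\in\mathbb{R}$. Let $A(v,\alpha)$ be the operator in $L_2(-\infty,+\infty)$ acting by $$A(v,\alpha)\psi(x)=i\psi'(x)+v(x)\Big[\tfrac12\psi(-0)+\tfrac{e^{-i\alpha}}{2}\psi(+0)\Big],\quad x\ne0,$$ on the domain of all $\psi\in W_2^1(\Omega)$ with $i\psi(-0)-ie^{-i\alpha}\psi(+0)=\langle\psi,v\rangle$. Then $A(v,\alpha)$ is self-adjoint in $L_2$. For nonreal $z$, $(A(v,\alpha)-zI)^{-1}$ is the integral operator with kernel $$\mathcal{G}_z(x,y;v,\alpha)=\mathcal{G}_z(x,y;\alpha)+\frac{1}{\gamma(z)}\sum_{j,k=1}^2E_j(x,z)\gamma_{jk}(z)\overline{E_k(y,\bar z)},$$ where $E_1(x,z)=\mathcal{G}_z(x,-0;\alpha)$ (the limit as $y\to0^-$), $E_2(x,z)=\int\mathcal{G}_z(x,y;\alpha)v(y)\,dy$, and $$\gamma_{11}(z)=-\langle E_2(\cdot,z),v\rangle,\quad \gamma_{12}(z)=1+\langle v,E_1(\cdot,\bar z)\rangle,\quad \gamma_{21}(z)=1+\langle E_1(\cdot,z),v\rangle,\quad \gamma_{22}(z)=-\tfrac{i}{2}\mathrm{sign}(\mathrm{Im}\, z),$$ $$\gamma(z)=\gamma_{11}(z)\gamma_{22}(z)-\gamma_{12}(z)\gamma_{21}(z).$$ The matrix $\Gamma(z)=\|\gamma_{jk}(z)\|$ satisfies $\Gamma^*(\bar z)=\Gamma(z)$,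 and $\gamma(z)=\det\Gamma(z)$ satisfies $\overline{\gamma(\bar z)}=\gamma(z)\neq0$.
   Context: $\Omega=\mathbb{R}\setminus\{0\}$; $W_2^1(\Omega)$ consists of functions whose restrictions to each half-line belong to $W_2^1$ of that half-line; $\psi(\pm0)$ are one-sided limits at $0$; $\langle f,g\rangle=\int f\bar g\,dx$. $\theta$ is the Heaviside function. $g_z(x)=i\,\mathrm{sign}(\mathrm{Im}\, z)\theta(-x\,\mathrm{Im}\, z)e^{-izx}$, and $\mathcal{G}_z(x,y;\alpha)=g_z(x-y)+g_z(x)\beta(z,\alpha)\overline{g_{\bar z}(y)}$ with $\beta(z,\alpha)=i(1-e^{-i\alpha})\theta(\mathrm{Im}\, z)+i(e^{i\alpha}-1)\theta(-\mathrm{Im}\, z)$; this is the kernel of the resolvent of the operator $i\,d/dx$ on $\{\psi\in W_2^1(\Omega):\psi(+0)=e^{i\alpha}\psi(-0)\}$. *)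

theory Defs
  imports "HOL-Analysis.Analysis"
begin

definition L2 :: "(real \<Rightarrow> complex) set" where
  "L2 = {f. f \<in> borel_measurable lborel \<and> integrable lborel (\<lambda>x. (cmod (f x))\<^sup>2)}"

definition inner_L2 :: "(real \<Rightarrow> complex) \<Rightarrow> (real \<Rightarrow> complex) \<Rightarrow> complex" where
  "inner_L2 f g = (LINT x|lborel. f x * cnj (g x))"

text \<open>Self-adjointness of an operator A with domain D in L2 (elements of D are concrete
 representatives; equality in L2 is equality almost everywhere): D is dense, A maps D into L2,
 and A coincides with its adjoint A*, i.e. the pair (phi, eta) lies in the graph of A* iff it lies
 in the graph of A.\<close>

definition self_adjoint_L2 :: "(real \<Rightarrow> complex) set \<Rightarrow> ((real \<Rightarrow> complex) \<Rightarrow> (real \<Rightarrow> complex)) \<Rightarrow> bool" where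
  "self_adjoint_L2 D A \<longleftrightarrow>
     D \<subseteq> L2 \<and> (\<forall>\<psi>\<in>D. A \<psi> \<in> L2) \<and>
     (\<forall>f\<in>L2. \<forall>e>0. \<exists>\<psi>\<in>D. (LINT x|lborel. (cmod (f x - \<psi> x))\<^sup>2) < e) \<and>
     (\<forall>\<phi>\<in>L2. \<forall>\<eta>\<in>L2.
        (\<forall>\<psi>\<in>D. inner_L2 (A \<psi>) \<phi> = inner_L2 \<psi> \<eta>) \<longleftrightarrow>
        (\<exists>\<phi>'\<in>D. (AE x in lborel. \<phi> x = \<phi>' x) \<and> (AE x in lborel. \<eta> x = A \<phi>' x)))"

text \<open>d is a (weak) derivative of psi on each half-line: psi is the integral of d on every
 compact interval contained in one of the half-lines (absolutely continuous representative).\<close>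

definition weak_deriv_Omega :: "(real \<Rightarrow> complex) \<Rightarrow> (real \<Rightarrow> complex) \<Rightarrow> bool" where
  "weak_deriv_Omega \<psi> d \<longleftrightarrow>
     (\<forall>x y. (0 < x \<and> x \<le> y \<or> x \<le> y \<and> y < 0) \<longrightarrow>
        set_integrable lborel {x..y} d \<and> \<psi> y - \<psi> x = (LINT t:{x..y}|lborel. d t))"

definition W21_Omega :: "(real \<Rightarrow> complex) set" where
  "W21_Omega = {\<psi>. \<psi> \<in> L2 \<and> (\<exists>d\<in>L2. weak_deriv_Omega \<psi> d)}"

definition Wderiv :: "(real \<Rightarrow> complex) \<Rightarrow> (real \<Rightarrow> complex)" where
  "Wderiv \<psi> = (SOME d. d \<in> L2 \<and> weak_deriv_Omega \<psi> d)"

definition bv_plus :: "(real \<Rightarrow> complex) \<Rightarrow> complex" where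
  "bv_plus \<psi> = Lim (at_right 0) \<psi>"

definition bv_minus :: "(real \<Rightarrow> complex) \<Rightarrow> complex" where
  "bv_minus \<psi> = Lim (at_left 0) \<psi>"

definition DomA :: "(real \<Rightarrow> complex) \<Rightarrow> real \<Rightarrow> (real \<Rightarrow> complex) set" where
  "DomA v \<alpha> = {\<psi>. \<psi> \<in> W21_Omega \<and>
      \<i> * bv_minus \<psi> - \<i> * exp (- \<i> * of_real \<alpha>) * bv_plus \<psi> = inner_L2 \<psi> v}"

definition opA :: "(real \<Rightarrow> complex) \<Rightarrow> real \<Rightarrow> (real \<Rightarrow> complex) \<Rightarrow> (real \<Rightarrow> complex)" where
  "opA v \<alpha> \<psi> = (\<lambda>x. \<i> * Wderiv \<psi> x +
      v x * (bv_minus \<psi> / 2 + exp (- \<i> * of_real \<alpha>) / 2 * bv_plus \<psi>))"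

definition heaviside :: "real \<Rightarrow> complex" where
  "heaviside t = (if t > 0 then 1 else 0)"

definition gz :: "complex \<Rightarrow> real \<Rightarrow> complex" where
  "gz z x = \<i> * of_real (sgn (Im z)) * heaviside (- x * Im z) * exp (- \<i> * z * of_real x)"

definition beta :: "complex \<Rightarrow> real \<Rightarrow> complex" where
  "beta z \<alpha> = \<i> * (1 - exp (- \<i> * of_real \<alpha>)) * heaviside (Im z)
             + \<i> * (exp (\<i> * of_real \<alpha>) - 1) * heaviside (- Im z)"

definition G0 :: "complex \<Rightarrow> real \<Rightarrow> real \<Rightarrow> real \<Rightarrow> complex" where
  "G0 z x y \<alpha> = gz z (x - y) + gz z x * beta z \<alpha> * cnj (gz (cnj z) y)"

definition E :: "(real \<Rightarrow> complex) \<Rightarrow> real \<Rightarrow> nat \<Rightarrow> real \<Rightarrow> complex \<Rightarrow> complex" where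
  "E v \<alpha> j x z = (if j = 1 then Lim (at_left 0) (\<lambda>y. G0 z x y \<alpha>)
                   else LINT y|lborel. G0 z x y \<alpha> * v y)"

definition gam :: "(real \<Rightarrow> complex) \<Rightarrow> real \<Rightarrow> nat \<Rightarrow> nat \<Rightarrow> complex \<Rightarrow> complex" where
  "gam v \<alpha> j k z =
     (if j = 1 \<and> k = 1 then - inner_L2 (\<lambda>x. E v \<alpha> 2 x z) v
      else if j = 1 \<and> k = 2 then 1 + inner_L2 v (\<lambda>x. E v \<alpha> 1 x (cnj z))
      else if j = 2 \<and> k = 1 then 1 + inner_L2 (\<lambda>x. E v \<alpha> 1 x z) v
      else - \<i> / 2 * of_real (sgn (Im z)))"

definition gamma_det :: "(real \<Rightarrow> complex) \<Rightarrow> real \<Rightarrow> complex \<Rightarrow> complex" where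
  "gamma_det v \<alpha> z = gam v \<alpha> 1 1 z * gam v \<alpha> 2 2 z - gam v \<alpha> 1 2 z * gam v \<alpha> 2 1 z"

definition Gv :: "(real \<Rightarrow> complex) \<Rightarrow> real \<Rightarrow> complex \<Rightarrow> real \<Rightarrow> real \<Rightarrow> complex" where
  "Gv v \<alpha> z x y = G0 z x y \<alpha> + 1 / gamma_det v \<alpha> z *
     (\<Sum>j\<in>{1,2}. \<Sum>k\<in>{1,2}. E v \<alpha> j x z * gam v \<alpha> j k z * cnj (E v \<alpha> k y (cnj z)))"

end

theory Submission
  imports Defs
begin

text \<open>Off the origin the unperturbed kernel is the gauge transform \<open>m(x) g\<^sub>z(x - y) cnj (m(y))\<close> of
  the free kernel, where \<open>m\<close> equals \<open>e\<^sup>i\<^sup>\<alpha>\<close> on the right and \<open>1\<close> on the left half-line. Hence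
  \<open>E\<^sub>1 = m g\<^sub>z\<close>, and \<open>E\<^sub>2\<close> is the unperturbed resolvent applied to \<open>v\<close>. Looking for a solution of
  \<open>(A - z) u = f\<close> of the form \<open>u = R f + c\<^sub>1 E\<^sub>1 + c\<^sub>2 E\<^sub>2\<close> leads to a linear system for
  \<open>(c\<^sub>1, c\<^sub>2)\<close> whose determinant is \<open>\<gamma>(z)\<close>, and Cramer's rule gives the asserted kernel.
  A zero of \<open>\<gamma>(z)\<close> would produce an eigenfunction of the symmetric operator \<open>A\<close> with the nonreal
  eigenvalue \<open>z\<close>. Symmetry is Green's identity for weak derivatives on the two half-lines, and
  self-adjointness follows from symmetry, density of the domain and surjectivity of \<open>A \<plusminus> i\<close>.\<close>

subsection \<open>Weak derivatives on intervals\<close>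

text \<open>Domain elements are concrete functions, whereas equality in L2 is almost everywhere and
  \<open>Wderiv\<close> is an arbitrary choice of derivative. Density of W_2^1 in L2 therefore comes
  early: with Green's identity it makes weak derivatives unique a.e. The gauge formula is restricted
  to nonzero arguments because g_z vanishes at 0 and m(0) = 1; the origin is passed over as a null
  set. The linear system comes from splitting boundary data into a jump and a mean. R f and E_2 have
  jump 0 and E_1 has jump -1, so -c_1 is the jump of u, while -c_2 has to be its mean for the
  multiples of v to cancel. The matrix of the system is the adjugate of \<Gamma>, which is why
  \<Gamma> itself, divided by \<gamma>, enters the kernel. Density of the domain of A is an obstacle
  of its own: the boundary condition equates the jump, which is discontinuous in the L2 norm, with
  the continuous functional <psi, v>. The discontinuity is also the cure: g_z at z = i n has jump -1
  and squared norm 1/(2n), so a bounded multiple of it repairs the boundary condition at a cost that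
  vanishes as n grows.\<close>

definition weak_deriv_on :: "real set \<Rightarrow> (real \<Rightarrow> complex) \<Rightarrow> (real \<Rightarrow> complex) \<Rightarrow> bool" where
  "weak_deriv_on S f d \<longleftrightarrow> (\<forall>x\<in>S. \<forall>y\<in>S. x \<le> y \<longrightarrow>
     set_integrable lborel {x..y} d \<and> f y - f x = (LINT t:{x..y}|lborel. d t))"

lemma weak_deriv_Omega_iff:
  "weak_deriv_Omega f d \<longleftrightarrow> weak_deriv_on {0<..} f d \<and> weak_deriv_on {..<0} f d"
  unfolding weak_deriv_Omega_def weak_deriv_on_def by auto

lemma weak_deriv_onD:
  assumes "weak_deriv_on S f d" "x \<in> S" "y \<in> S" "x \<le> y"
  shows "set_integrable lborel {x..y} d" "f y - f x = (LINT t:{x..y}|lborel. d t)"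
  using assms unfolding weak_deriv_on_def by blast+

lemma weak_deriv_on_subset:
  "weak_deriv_on S f d \<Longrightarrow> T \<subseteq> S \<Longrightarrow> weak_deriv_on T f d"
  unfolding weak_deriv_on_def by blast

lemma weak_deriv_on_cong:
  assumes "weak_deriv_on S f d" "\<And>x. x \<in> S \<Longrightarrow> f x = f' x" "\<And>x. x \<in> S \<Longrightarrow> d x = d' x" "is_interval S"
  shows "weak_deriv_on S f' d'"
  unfolding weak_deriv_on_def
proof (intro ballI impI)
  fix x y assume xy: "x \<in> S" "y \<in> S" "x \<le> y"
  then have sub: "{x..y} \<subseteq> S"
    using assms(4) by (meson atLeastAtMost_iff mem_is_interval_1_I subsetI)
  have "set_integrable lborel {x..y} d' = set_integrable lborel {x..y} d"
    using assms(3) sub by (intro set_integrable_cong) auto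
  moreover have "(LINT t:{x..y}|lborel. d' t) = (LINT t:{x..y}|lborel. d t)"
    using assms(3) sub by (intro set_lebesgue_integral_cong) auto
  ultimately show "set_integrable lborel {x..y} d' \<and> f' y - f' x = (LINT t:{x..y}|lborel. d' t)"
    using assms(1,2) xy unfolding weak_deriv_on_def by metis
qed

lemma weak_deriv_on_add:
  assumes "weak_deriv_on S f d" "weak_deriv_on S g e"
  shows "weak_deriv_on S (\<lambda>x. f x + g x) (\<lambda>x. d x + e x)"
  unfolding weak_deriv_on_def
proof (intro ballI impI)
  fix x y assume "x \<in> S" "y \<in> S" "x \<le> y"
  then have "set_integrable lborel {x..y} d" "set_integrable lborel {x..y} e"
    "f y - f x = (LINT t:{x..y}|lborel. d t)" "g y - g x = (LINT t:{x..y}|lborel. e t)"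
    using assms unfolding weak_deriv_on_def by auto
  then show "set_integrable lborel {x..y} (\<lambda>x. d x + e x) \<and>
     f y + g y - (f x + g x) = (LINT t:{x..y}|lborel. d t + e t)"
    by (simp add: set_integral_add algebra_simps)
qed

lemma weak_deriv_on_cmult:
  assumes "weak_deriv_on S f d"
  shows "weak_deriv_on S (\<lambda>x. c * f x) (\<lambda>x. c * d x)"
  using assms unfolding weak_deriv_on_def
  by (auto simp: right_diff_distrib[symmetric])

lemma weak_deriv_on_cnj:
  assumes "weak_deriv_on S f d"
  shows "weak_deriv_on S (\<lambda>x. cnj (f x)) (\<lambda>x. cnj (d x))"
  unfolding weak_deriv_on_def
proof (intro ballI impI)
  fix x y assume "x \<in> S" "y \<in> S" "x \<le> y"
  then have *: "set_integrable lborel {x..y} d" "f y - f x = (LINT t:{x..y}|lborel. d t)"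
    using assms unfolding weak_deriv_on_def by auto
  have "integrable lborel (\<lambda>t. cnj (indicat_real {x..y} t *\<^sub>R d t))"
    using *(1) unfolding set_integrable_def by (rule integrable_bounded_linear[OF bounded_linear_cnj])
  moreover have "cnj (f y - f x) = (LINT t|lborel. cnj (indicat_real {x..y} t *\<^sub>R d t))"
    using integral_bounded_linear[OF bounded_linear_cnj *(1)[unfolded set_integrable_def]] *(2)
    unfolding set_lebesgue_integral_def by simp
  ultimately show "set_integrable lborel {x..y} (\<lambda>x. cnj (d x)) \<and>
     cnj (f y) - cnj (f x) = (LINT t:{x..y}|lborel. cnj (d t))"
    unfolding set_integrable_def set_lebesgue_integral_def by simp
qed

text \<open>Reduces statements on the negative half-line to the positive one.\<close>

lemma weak_deriv_on_reflect:
  assumes "weak_deriv_on S f d"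
  shows "weak_deriv_on (uminus ` S) (\<lambda>x. f (- x)) (\<lambda>x. - d (- x))"
  unfolding weak_deriv_on_def
proof (intro ballI impI)
  fix x y assume xy: "x \<in> uminus ` S" "y \<in> uminus ` S" "x \<le> y"
  then have "-x \<in> S" "-y \<in> S" "-y \<le> -x" by auto
  then have *: "set_integrable lborel {-y..-x} d" "f (-x) - f (-y) = (LINT t:{-y..-x}|lborel. d t)"
    using assms unfolding weak_deriv_on_def by auto
  have ind: "indicat_real {-y..-x} (-t) = indicat_real {x..y} t" for t
    by (auto simp: indicator_def)
  have "integrable lborel (\<lambda>t. indicat_real {-y..-x} (0 + (-1) * t) *\<^sub>R d (0 + (-1) * t))"
    using *(1) unfolding set_integrable_def by (rule lborel_integrable_real_affine) simp
  then have "integrable lborel (\<lambda>t. - (indicat_real {x..y} t *\<^sub>R d (-t)))"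
    by (simp add: ind)
  moreover have "(LINT t:{-y..-x}|lborel. d t)
      = (LINT t|lborel. indicat_real {-y..-x} (0 + (-1) * t) *\<^sub>R d (0 + (-1) * t))"
    unfolding set_lebesgue_integral_def by (subst lborel_integral_real_affine[of "-1" _ 0]) auto
  ultimately show "set_integrable lborel {x..y} (\<lambda>x. - d (-x)) \<and>
     f (-y) - f (-x) = (LINT t:{x..y}|lborel. - d (-t))"
    using *(2) unfolding set_integrable_def set_lebesgue_integral_def
    by (auto simp: ind algebra_simps)
qed

lemma weak_deriv_on_C1:
  assumes "is_interval S" "\<And>x. x \<in> S \<Longrightarrow> (f has_vector_derivative d x) (at x)" "continuous_on S d"
  shows "weak_deriv_on S f d"
  unfolding weak_deriv_on_def
proof (intro ballI impI)
  fix x y assume xy: "x \<in> S" "y \<in> S" "x \<le> y"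
  then have sub: "{x..y} \<subseteq> S"
    using assms(1) by (meson atLeastAtMost_iff mem_is_interval_1_I subsetI)
  have cont: "continuous_on {x..y} d"
    using assms(3) sub continuous_on_subset by blast
  have "(LINT t|lborel. indicator {x..y} t *\<^sub>R d t) = f y - f x"
  proof (intro integral_FTC_atLeastAtMost xy cont)
    fix t assume "x \<le> t" "t \<le> y"
    with sub have "t \<in> S" by auto
    then show "(f has_vector_derivative d t) (at t within {x..y})"
      by (rule has_vector_derivative_at_within[OF assms(2)])
  qed
  then show "set_integrable lborel {x..y} d \<and> f y - f x = (LINT t:{x..y}|lborel. d t)"
    using borel_integrable_atLeastAtMost'[OF cont] by (simp add: set_lebesgue_integral_def)
qed

lemma weak_deriv_on_continuous:
  assumes "weak_deriv_on S f d" "{a..b} \<subseteq> S"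
  shows "continuous_on {a..b} f"
proof (cases "a \<le> b")
  case True
  then have ab: "a \<in> S" "b \<in> S" using assms(2) by auto
  have int: "set_integrable lborel {a..x} d" and eq: "f x = f a + (LINT t:{a..x}|lborel. d t)"
    if "x \<in> {a..b}" for x
  proof -
    have "x \<in> S" "a \<le> x" using that assms(2) by auto
    with ab assms(1) have "set_integrable lborel {a..x} d" "f x - f a = (LINT t:{a..x}|lborel. d t)"
      unfolding weak_deriv_on_def by blast+
    then show "set_integrable lborel {a..x} d" "f x = f a + (LINT t:{a..x}|lborel. d t)"
      by (auto simp: algebra_simps)
  qed
  have "d integrable_on {a..b}"
    using int[of b] True by (intro set_borel_integral_eq_integral) auto
  from indefinite_integral_continuous_1[OF this]
  have "continuous_on {a..b} (\<lambda>x. f a + integral {a..x} d)"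
    by (intro continuous_intros)
  moreover have "f a + integral {a..x} d = f x" if "x \<in> {a..b}" for x
    using eq[OF that] set_borel_integral_eq_integral(2)[OF int[OF that]] by simp
  ultimately show ?thesis by (rule continuous_on_eq)
qed simp

text \<open>Integration by parts through Fubini. With \<open>D\<close> and \<open>G\<close> the two
  derivatives cut off to \<open>{a..b}\<close>, the product of the increments of f and g is the
  integral of \<open>D s * G t\<close> over the plane. Splitting the plane along the diagonal turns
  the inner integrals into increments \<open>g s - g a\<close> and \<open>f t - f a\<close>.\<close>

lemma weak_deriv_on_mult:
  assumes S: "is_interval S" and f: "weak_deriv_on S f d" and g: "weak_deriv_on S g e"
  shows "weak_deriv_on S (\<lambda>x. f x * g x) (\<lambda>x. d x * g x + f x * e x)"
  unfolding weak_deriv_on_def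
proof (intro ballI impI)
  fix a b assume ab: "a \<in> S" "b \<in> S" "a \<le> b"
  then have sub: "{a..b} \<subseteq> S"
    using S by (meson atLeastAtMost_iff mem_is_interval_1_I subsetI)
  define D where "D x = indicat_real {a..b} x *\<^sub>R d x" for x
  define G where "G x = indicat_real {a..b} x *\<^sub>R e x" for x
  have intD: "integrable lborel D" and intG: "integrable lborel G"
    and fb: "f b - f a = (LINT t|lborel. D t)" and gb: "g b - g a = (LINT t|lborel. G t)"
    using f g ab unfolding weak_deriv_on_def set_integrable_def set_lebesgue_integral_def D_def G_def
    by blast+
  have [measurable]: "D \<in> borel_measurable borel" "G \<in> borel_measurable borel"
    using intD intG by auto
  have fx: "f x = f a + (LINT t|lborel. indicat_real {..x} t *\<^sub>R D t)"
    and gx: "g x = g a + (LINT t|lborel. indicat_real {..x} t *\<^sub>R G t)"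
    if "x \<in> {a..b}" for x
  proof -
    have "x \<in> S" "a \<le> x" using sub that by auto
    then have "f x - f a = (LINT t|lborel. indicat_real {a..x} t *\<^sub>R d t)"
      "g x - g a = (LINT t|lborel. indicat_real {a..x} t *\<^sub>R e t)"
      using f g ab unfolding weak_deriv_on_def set_lebesgue_integral_def by blast+
    moreover have "indicat_real {a..x} t = indicat_real {..x} t * indicat_real {a..b} t" for t
      using that by (auto simp: indicator_def)
    ultimately show "f x = f a + (LINT t|lborel. indicat_real {..x} t *\<^sub>R D t)"
      "g x = g a + (LINT t|lborel. indicat_real {..x} t *\<^sub>R G t)"
      unfolding D_def G_def by (simp_all add: algebra_simps)
  qed
  have intP: "integrable (lborel \<Otimes>\<^sub>M lborel) (\<lambda>(s, t). D s * G t)"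
  proof (rule lborel_pair.Fubini_integrable)
    show "integrable lborel (\<lambda>x. LINT y|lborel. cmod (case (x, y) of (s, t) \<Rightarrow> D s * G t))"
      using intD by (simp add: norm_mult)
  qed (use intG in auto)
  have intL: "integrable (lborel \<Otimes>\<^sub>M lborel) (\<lambda>(s, t). indicat_real {..s} t *\<^sub>R (D s * G t))"
    by (rule Bochner_Integration.integrable_bound[OF intP])
       (auto simp: indicator_def, measurable)
  have intU: "integrable (lborel \<Otimes>\<^sub>M lborel) (\<lambda>(s, t). indicat_real {..t} s *\<^sub>R (D s * G t))"
    by (rule Bochner_Integration.integrable_bound[OF intP])
       (auto simp: indicator_def, measurable)
  have 1: "D s * (g s - g a) = (LINT t|lborel. indicat_real {..s} t *\<^sub>R (D s * G t))" for s
  proof (cases "s \<in> {a..b}")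
    case True
    have "(LINT t|lborel. indicat_real {..s} t *\<^sub>R (D s * G t))
        = (LINT t|lborel. D s * (indicat_real {..s} t *\<^sub>R G t))"
      by (simp add: algebra_simps)
    with gx[OF True] show ?thesis by (simp only: integral_mult_right_zero) simp
  qed (simp add: D_def)
  have 2: "(f t - f a) * G t = (LINT s|lborel. indicat_real {..t} s *\<^sub>R (D s * G t))" for t
  proof (cases "t \<in> {a..b}")
    case True
    have "(LINT s|lborel. indicat_real {..t} s *\<^sub>R (D s * G t))
        = (LINT s|lborel. (indicat_real {..t} s *\<^sub>R D s) * G t)"
      by (simp add: algebra_simps)
    with fx[OF True] show ?thesis by (simp only: integral_mult_left_zero) simp
  qed (simp add: G_def)
  have i1: "integrable lborel (\<lambda>s. D s * (g s - g a))"
    unfolding 1 using lborel_pair.integrable_fst'[OF intL] by simp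
  have i2: "integrable lborel (\<lambda>t. (f t - f a) * G t)"
    unfolding 2 using lborel_pair.integrable_snd[of "\<lambda>s t. indicat_real {..t} s *\<^sub>R (D s * G t)"] intU by simp
  have "(LINT s|lborel. D s * (g s - g a)) + (LINT t|lborel. (f t - f a) * G t)
     = (LINT p|(lborel \<Otimes>\<^sub>M lborel). (\<lambda>(s, t). indicat_real {..s} t *\<^sub>R (D s * G t)) p)
     + (LINT p|(lborel \<Otimes>\<^sub>M lborel). (\<lambda>(s, t). indicat_real {..t} s *\<^sub>R (D s * G t)) p)"
    unfolding 1 2 using lborel_pair.integral_fst'[OF intL]
      lborel_pair.integral_snd[of "\<lambda>s t. indicat_real {..t} s *\<^sub>R (D s * G t)"] intU by simp
  also have "\<dots> = (LINT p|(lborel \<Otimes>\<^sub>M lborel). (\<lambda>(s, t). indicat_real {..s} t *\<^sub>R (D s * G t)) p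
     + (\<lambda>(s, t). indicat_real {..t} s *\<^sub>R (D s * G t)) p)"
    by (rule Bochner_Integration.integral_add[symmetric, OF intL intU])
  also have "\<dots> = (LINT s|lborel. LINT t|lborel. indicat_real {..s} t *\<^sub>R (D s * G t)
     + indicat_real {..t} s *\<^sub>R (D s * G t))"
    using lborel_pair.integral_fst'[OF Bochner_Integration.integrable_add[OF intL intU]] by simp
  \<comment> \<open>For fixed s the two indicators add up to 1 except at t = s, where they add up to
    2; a single point does not affect the inner integral.\<close>
  also have "\<dots> = (LINT s|lborel. LINT t|lborel. D s * G t)"
    by (intro Bochner_Integration.integral_cong refl integral_discrete_difference[where X="{s}" for s])
       (auto simp: indicator_def)
  also have "\<dots> = (f b - f a) * (g b - g a)"
    unfolding fb gb by simp
  finally have eq: "(LINT s|lborel. D s * (g s - g a)) + (LINT t|lborel. (f t - f a) * G t)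
     = (f b - f a) * (g b - g a)" .
  have j: "indicat_real {a..b} x *\<^sub>R (d x * g x + f x * e x)
      = (D x * (g x - g a) + (f x - f a) * G x) + (g a * D x + f a * G x)" for x
    unfolding D_def G_def by (simp add: algebra_simps)
  have k: "integrable lborel (\<lambda>x. D x * (g x - g a) + (f x - f a) * G x)"
    "integrable lborel (\<lambda>x. g a * D x + f a * G x)"
    using i1 i2 intD intG by auto
  have "integrable lborel (\<lambda>x. indicat_real {a..b} x *\<^sub>R (d x * g x + f x * e x))"
    unfolding j using k by simp
  moreover have "(LINT x|lborel. indicat_real {a..b} x *\<^sub>R (d x * g x + f x * e x))
     = (f b - f a) * (g b - g a) + (g a * (f b - f a) + f a * (g b - g a))"
    unfolding j Bochner_Integration.integral_add[OF k] using eq i1 i2 intD intG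
    by (simp add: fb gb)
  ultimately show "set_integrable lborel {a..b} (\<lambda>x. d x * g x + f x * e x) \<and>
     f b * g b - f a * g a = (LINT x:{a..b}|lborel. d x * g x + f x * e x)"
    unfolding set_integrable_def set_lebesgue_integral_def by (simp add: algebra_simps)
qed

subsection \<open>Square-integrable functions and Green's identity\<close>

lemma L2_measurable [measurable_dest]: "f \<in> L2 \<Longrightarrow> f \<in> borel_measurable borel"
  unfolding L2_def by simp

lemma L2_integrable: "f \<in> L2 \<Longrightarrow> integrable lborel (\<lambda>x. (cmod (f x))\<^sup>2)"
  unfolding L2_def by simp

lemma L2_bound:
  assumes "f \<in> L2" and g [measurable]: "g \<in> borel_measurable borel" and le: "\<And>x. cmod (g x) \<le> C * cmod (f x)"
  shows "g \<in> L2"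
proof -
  have "integrable lborel (\<lambda>x. (cmod (g x))\<^sup>2)"
  proof (rule Bochner_Integration.integrable_bound)
    show "integrable lborel (\<lambda>x. C\<^sup>2 * (cmod (f x))\<^sup>2)"
      using assms(1) L2_integrable by simp
    show "AE x in lborel. norm ((cmod (g x))\<^sup>2) \<le> norm (C\<^sup>2 * (cmod (f x))\<^sup>2)"
      using power_mono[OF le norm_ge_zero, of _ 2] by (simp add: power_mult_distrib)
  qed measurable
  then show ?thesis unfolding L2_def by simp
qed

lemma L2_cmult: "f \<in> L2 \<Longrightarrow> (\<lambda>x. c * f x) \<in> L2"
  by (rule L2_bound[where C="cmod c"]) (auto simp: norm_mult intro!: borel_measurable_times L2_measurable)

lemma L2_cnj: "f \<in> L2 \<Longrightarrow> (\<lambda>x. cnj (f x)) \<in> L2"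
  by (rule L2_bound[where C=1 and f=f])
     (use measurable_compose[OF L2_measurable borel_measurable_continuous_onI[OF continuous_on_cnj[OF continuous_on_id]]] in auto)

lemma L2_uminus: "f \<in> L2 \<Longrightarrow> (\<lambda>x. - f x) \<in> L2"
  using L2_cmult[of f "-1"] by simp

lemma cmod_add_square_le: "(cmod (a + b))\<^sup>2 \<le> 2 * (cmod a)\<^sup>2 + 2 * (cmod b)\<^sup>2"
proof -
  have "(cmod (a + b))\<^sup>2 \<le> (cmod a + cmod b)\<^sup>2"
    by (intro power_mono norm_triangle_ineq) auto
  also have "\<dots> \<le> 2 * (cmod a)\<^sup>2 + 2 * (cmod b)\<^sup>2"
    using sum_squares_bound[of "cmod a" "cmod b"] by (simp add: power2_sum)
  finally show ?thesis .
qed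

lemma L2_add:
  assumes f: "f \<in> L2" and g: "g \<in> L2"
  shows "(\<lambda>x. f x + g x) \<in> L2"
proof -
  note [measurable] = L2_measurable[OF f] L2_measurable[OF g]
  have "integrable lborel (\<lambda>x. (cmod (f x + g x))\<^sup>2)"
  proof (rule Bochner_Integration.integrable_bound)
    show "integrable lborel (\<lambda>x. 2 * (cmod (f x))\<^sup>2 + 2 * (cmod (g x))\<^sup>2)"
      using f g L2_integrable by simp
  qed (auto intro!: cmod_add_square_le)
  then show ?thesis unfolding L2_def by simp
qed

lemma L2_diff: "f \<in> L2 \<Longrightarrow> g \<in> L2 \<Longrightarrow> (\<lambda>x. f x - g x) \<in> L2"
  using L2_add[OF _ L2_uminus, of f g] by simp

text \<open>Weighted AM-GM. Its free weight t lets the integrated form do the work of the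
  Cauchy-Schwarz inequality for L2.\<close>

lemma cmod_mult_le: 
  assumes "t > 0"
  shows "cmod (a * b) \<le> (t * (cmod a)\<^sup>2 + (cmod b)\<^sup>2 / t) / 2"
proof -
  have "0 \<le> (sqrt t * cmod a - cmod b / sqrt t)\<^sup>2" by simp
  also have "\<dots> = t * (cmod a)\<^sup>2 + (cmod b)\<^sup>2 / t - 2 * (cmod a * cmod b)"
    using assms by (simp add: power2_diff power_mult_distrib power_divide)
  finally show ?thesis by (simp add: norm_mult)
qed

lemma L2_mult_integrable:
  assumes f: "f \<in> L2" and g: "g \<in> L2"
  shows "integrable lborel (\<lambda>x. f x * g x)"
proof (rule Bochner_Integration.integrable_bound)
  note [measurable] = L2_measurable[OF f] L2_measurable[OF g]
  show "integrable lborel (\<lambda>x. (1 * (cmod (f x))\<^sup>2 + (cmod (g x))\<^sup>2 / 1) / 2)"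
    using f g L2_integrable by simp
  show "(\<lambda>x. f x * g x) \<in> borel_measurable lborel" by measurable
  show "AE x in lborel. cmod (f x * g x) \<le> norm ((1 * (cmod (f x))\<^sup>2 + (cmod (g x))\<^sup>2 / 1) / 2)"
    using cmod_mult_le[of 1] by (auto intro: order.trans[OF _ abs_ge_self])
qed

lemma L2_inner_integrable:
  "f \<in> L2 \<Longrightarrow> g \<in> L2 \<Longrightarrow> integrable lborel (\<lambda>x. f x * cnj (g x))"
  by (intro L2_mult_integrable L2_cnj)

lemma LINT_mult_le:
  assumes f: "f \<in> L2" and g: "g \<in> L2" and t: "t > 0"
  shows "cmod (LINT x|lborel. f x * g x)
    \<le> (t * (LINT x|lborel. (cmod (f x))\<^sup>2) + (LINT x|lborel. (cmod (g x))\<^sup>2) / t) / 2"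
proof -
  have "cmod (LINT x|lborel. f x * g x) \<le> (LINT x|lborel. (t * (cmod (f x))\<^sup>2 + (cmod (g x))\<^sup>2 / t) / 2)"
    using t by (intro Bochner_Integration.integral_norm_bound_integral L2_mult_integrable cmod_mult_le f g)
      (simp add: L2_integrable f g)
  also have "\<dots> = (t * (LINT x|lborel. (cmod (f x))\<^sup>2) + (LINT x|lborel. (cmod (g x))\<^sup>2) / t) / 2"
    using f g L2_integrable by simp
  finally show ?thesis .
qed

lemma inner_L2_le:
  assumes f: "f \<in> L2" and g: "g \<in> L2" and t: "t > 0"
  shows "cmod (inner_L2 f g)
    \<le> (t * (LINT x|lborel. (cmod (f x))\<^sup>2) + (LINT x|lborel. (cmod (g x))\<^sup>2) / t) / 2"
  using LINT_mult_le[OF f L2_cnj[OF g] t] unfolding inner_L2_def by simp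

lemma L2_cong_AE:
  assumes "f \<in> L2" "g \<in> borel_measurable borel" "AE x in lborel. f x = g x"
  shows "g \<in> L2"
proof -
  note [measurable] = L2_measurable[OF assms(1)] assms(2)
  have "integrable lborel (\<lambda>x. (cmod (g x))\<^sup>2) = integrable lborel (\<lambda>x. (cmod (f x))\<^sup>2)"
    by (intro integrable_cong_AE) (use assms(3) in auto)
  then show ?thesis using assms(1,2) unfolding L2_def by simp
qed

lemma borel_measurable_cong_off_0:
  fixes f g :: "real \<Rightarrow> complex"
  assumes "f \<in> borel_measurable borel" "\<And>x. x \<noteq> 0 \<Longrightarrow> f x = g x"
  shows "g \<in> borel_measurable borel"
  using assms by (intro measurable_discrete_difference[of f borel borel "{0}" g]) auto

lemma AE_not_0: "AE x in lborel. x \<noteq> (0::real)"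
  by (rule AE_lborel_singleton)

lemma AE_off_0: "(\<And>x. x \<noteq> (0::real) \<Longrightarrow> P x) \<Longrightarrow> AE x in lborel. P x"
  using AE_not_0 by (rule AE_mp) auto

lemma L2_cong_off_0:
  assumes "f \<in> L2" "\<And>x. x \<noteq> 0 \<Longrightarrow> f x = g x"
  shows "g \<in> L2"
  using assms(1) borel_measurable_cong_off_0[OF L2_measurable[OF assms(1)] assms(2)] AE_off_0[OF assms(2)]
  by (rule L2_cong_AE)

lemma LINT_cong_off_0:
  fixes f g :: "real \<Rightarrow> complex"
  assumes "\<And>x. x \<noteq> 0 \<Longrightarrow> f x = g x"
  shows "(LINT x|lborel. f x) = (LINT x|lborel. g x)"
  by (rule integral_discrete_difference[where X="{0}"]) (use assms in auto)

lemma inner_L2_cong_AE: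
  assumes "f \<in> L2" "f' \<in> L2" "g \<in> L2" "g' \<in> L2" "AE x in lborel. f x = f' x" "AE x in lborel. g x = g' x"
  shows "inner_L2 f g = inner_L2 f' g'"
  unfolding inner_L2_def
  using assms(5,6)
  by (intro integral_cong_AE borel_measurable_integrable L2_inner_integrable assms(1-4)) auto

lemma inner_L2_add_left:
  "f \<in> L2 \<Longrightarrow> g \<in> L2 \<Longrightarrow> h \<in> L2 \<Longrightarrow> inner_L2 (\<lambda>x. f x + g x) h = inner_L2 f h + inner_L2 g h"
  unfolding inner_L2_def by (simp add: distrib_right L2_inner_integrable)

lemma inner_L2_diff_left:
  "f \<in> L2 \<Longrightarrow> g \<in> L2 \<Longrightarrow> h \<in> L2 \<Longrightarrow> inner_L2 (\<lambda>x. f x - g x) h = inner_L2 f h - inner_L2 g h"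
  unfolding inner_L2_def by (simp add: left_diff_distrib L2_inner_integrable)

lemma inner_L2_cmult_left: "inner_L2 (\<lambda>x. c * f x) h = c * inner_L2 f h"
  unfolding inner_L2_def by (simp add: mult.assoc)

lemma inner_L2_commute:
  assumes "f \<in> L2" "g \<in> L2"
  shows "inner_L2 g f = cnj (inner_L2 f g)"
  using integral_bounded_linear[OF bounded_linear_cnj L2_inner_integrable[OF assms]]
  unfolding inner_L2_def by (simp add: mult.commute)

lemma inner_L2_add_right:
  "f \<in> L2 \<Longrightarrow> g \<in> L2 \<Longrightarrow> h \<in> L2 \<Longrightarrow> inner_L2 h (\<lambda>x. f x + g x) = inner_L2 h f + inner_L2 h g"
  unfolding inner_L2_def by (simp add: distrib_left L2_inner_integrable)

lemma inner_L2_diff_right: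
  "f \<in> L2 \<Longrightarrow> g \<in> L2 \<Longrightarrow> h \<in> L2 \<Longrightarrow> inner_L2 h (\<lambda>x. f x - g x) = inner_L2 h f - inner_L2 h g"
  unfolding inner_L2_def by (simp add: right_diff_distrib L2_inner_integrable)

lemma inner_L2_cmult_right: "inner_L2 h (\<lambda>x. c * f x) = cnj c * inner_L2 h f"
  unfolding inner_L2_def by (simp add: mult.left_commute)

lemma inner_L2_self: "inner_L2 f f = of_real (LINT x|lborel. (cmod (f x))\<^sup>2)"
  unfolding inner_L2_def by (simp add: complex_norm_square[symmetric] del: of_real_power)

lemma L2_AE_zero:
  assumes "f \<in> L2" "(LINT x|lborel. (cmod (f x))\<^sup>2) = 0"
  shows "AE x in lborel. f x = 0"
  using assms integral_nonneg_eq_0_iff_AE[OF L2_integrable[OF assms(1)]] by simp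

text \<open>The indicator of a set of finite measure is itself in L2, so this is integrability of a
  product of two L2 functions.\<close>

lemma L2_set_integrable:
  assumes f: "f \<in> L2" and A: "A \<in> sets borel" "emeasure lborel A < \<infinity>"
  shows "set_integrable lborel A f"
proof -
  have "(\<lambda>x. complex_of_real (indicator A x)) \<in> L2"
    unfolding L2_def
  proof (intro CollectI conjI)
    have "integrable lborel (indicat_real A)" using A by simp
    moreover have "(cmod (complex_of_real (indicator A x)))\<^sup>2 = indicat_real A x" for x
      by (simp add: indicator_def)
    ultimately show "integrable lborel (\<lambda>x. (cmod (complex_of_real (indicator A x)))\<^sup>2)" by simp
  qed (use A in measurable)
  from L2_mult_integrable[OF this f] show ?thesis
    unfolding set_integrable_def by (simp add: scaleR_conv_of_real)
qed

section \<open>One-sided limits at the origin and Green's identity\<close>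

definition W21_deriv :: "(real \<Rightarrow> complex) \<Rightarrow> (real \<Rightarrow> complex) \<Rightarrow> bool" where
  "W21_deriv f d \<longleftrightarrow> f \<in> L2 \<and> d \<in> L2 \<and> weak_deriv_Omega f d"

lemma W21_derivD:
  assumes "W21_deriv f d"
  shows "f \<in> L2" "d \<in> L2" "weak_deriv_on {0<..} f d" "weak_deriv_on {..<0} f d"
  using assms unfolding W21_deriv_def weak_deriv_Omega_iff by auto

lemma W21_derivI:
  "f \<in> L2 \<Longrightarrow> d \<in> L2 \<Longrightarrow> weak_deriv_on {0<..} f d \<Longrightarrow> weak_deriv_on {..<0} f d \<Longrightarrow> W21_deriv f d"
  unfolding W21_deriv_def weak_deriv_Omega_iff by auto

lemma W21_Omega_iff: "f \<in> W21_Omega \<longleftrightarrow> (\<exists>d. W21_deriv f d)"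
  unfolding W21_Omega_def W21_deriv_def by auto

text \<open>\<open>Wderiv\<close> is a Hilbert choice; this lemma and a.e. uniqueness are all that
  is known about it. Computations use \<open>W21_deriv\<close> with an explicit derivative
  instead.\<close>

lemma W21_deriv_Wderiv: "f \<in> W21_Omega \<Longrightarrow> W21_deriv f (Wderiv f)"
  unfolding W21_Omega_def Wderiv_def W21_deriv_def
  by (auto intro: someI2_ex[where P="\<lambda>d. d \<in> L2 \<and> weak_deriv_Omega f d"])

lemma W21_deriv_add:
  "W21_deriv f d \<Longrightarrow> W21_deriv g e \<Longrightarrow> W21_deriv (\<lambda>x. f x + g x) (\<lambda>x. d x + e x)"
  by (auto intro!: W21_derivI L2_add weak_deriv_on_add dest: W21_derivD)

lemma W21_deriv_cmult: "W21_deriv f d \<Longrightarrow> W21_deriv (\<lambda>x. c * f x) (\<lambda>x. c * d x)"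
  by (auto intro!: W21_derivI L2_cmult weak_deriv_on_cmult dest: W21_derivD)

lemma W21_deriv_cong_off_0:
  assumes "W21_deriv f d" "\<And>x. x \<noteq> 0 \<Longrightarrow> f x = f' x" "\<And>x. x \<noteq> 0 \<Longrightarrow> d x = d' x"
  shows "W21_deriv f' d'"
proof (rule W21_derivI)
  note f = W21_derivD[OF assms(1)]
  show "f' \<in> L2" "d' \<in> L2"
    by (rule L2_cong_off_0[OF f(1) assms(2)] L2_cong_off_0[OF f(2) assms(3)]; assumption)+
  show "weak_deriv_on {0<..} f' d'"
    by (rule weak_deriv_on_cong[OF f(3)]) (simp_all add: assms(2,3) is_interval_1)
  show "weak_deriv_on {..<0} f' d'"
    by (rule weak_deriv_on_cong[OF f(4)]) (simp_all add: assms(2,3) is_interval_1)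
qed

text \<open>An L2 derivative is integrable up to the origin, so \<open>f 1\<close> minus the
  integral of d from x to 1 converges as x decreases to 0, and similarly from the left. Hence the
  \<open>Lim\<close> terms in \<open>bv_plus\<close> and \<open>bv_minus\<close> are genuine
  limits.\<close>

lemma W21_deriv_tendsto:
  assumes "W21_deriv f d"
  shows "(f \<longlongrightarrow> bv_plus f) (at_right 0)" "(f \<longlongrightarrow> bv_minus f) (at_left 0)"
proof -
  note f = W21_derivD[OF assms]
  have "set_integrable lborel {0<..1} d" "set_integrable lborel {-1..<0} d"
    using f(2) by (auto intro!: L2_set_integrable)
  then have "((\<lambda>x. f 1 - (LINT t:{x..1}|lborel. d t)) \<longlongrightarrow> f 1 - (LINT t:{0<..1}|lborel. d t)) (at_right 0)"
    "((\<lambda>x. f (-1) + (LINT t:{-1..x}|lborel. d t)) \<longlongrightarrow> f (-1) + (LINT t:{-1..<0}|lborel. d t)) (at_left 0)"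
    by (intro tendsto_diff tendsto_add tendsto_const tendsto_set_lebesgue_integral_at_right
        tendsto_set_lebesgue_integral_at_left; simp)+
  moreover have "\<forall>\<^sub>F x in at_right 0. f 1 - (LINT t:{x..1}|lborel. d t) = f x"
    unfolding eventually_at_right_field
    by (intro exI[of _ 1]) (simp add: weak_deriv_onD(2)[OF f(3), symmetric])
  moreover have "\<forall>\<^sub>F x in at_left 0. f (-1) + (LINT t:{-1..x}|lborel. d t) = f x"
    unfolding eventually_at_left_field
    by (intro exI[of _ "-1"]) (simp add: weak_deriv_onD(2)[OF f(4), symmetric])
  ultimately have lim: "(f \<longlongrightarrow> f 1 - (LINT t:{0<..1}|lborel. d t)) (at_right 0)"
    "(f \<longlongrightarrow> f (-1) + (LINT t:{-1..<0}|lborel. d t)) (at_left 0)"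
    by (auto elim: Lim_transform_eventually)
  show "(f \<longlongrightarrow> bv_plus f) (at_right 0)" "(f \<longlongrightarrow> bv_minus f) (at_left 0)"
    unfolding bv_plus_def bv_minus_def using lim tendsto_Lim[OF _ lim(1)] tendsto_Lim[OF _ lim(2)] by simp_all
qed

lemma bv_eqI:
  "(f \<longlongrightarrow> a) (at_right 0) \<Longrightarrow> bv_plus f = a" "(f \<longlongrightarrow> b) (at_left 0) \<Longrightarrow> bv_minus f = b"
  unfolding bv_plus_def bv_minus_def by (auto intro!: tendsto_Lim)

lemma bv_add:
  assumes "W21_deriv f d" "W21_deriv g e"
  shows "bv_plus (\<lambda>x. f x + g x) = bv_plus f + bv_plus g" "bv_minus (\<lambda>x. f x + g x) = bv_minus f + bv_minus g"
  by (intro bv_eqI tendsto_add W21_deriv_tendsto[OF assms(1)] W21_deriv_tendsto[OF assms(2)])+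

lemma bv_cmult:
  assumes "W21_deriv f d"
  shows "bv_plus (\<lambda>x. c * f x) = c * bv_plus f" "bv_minus (\<lambda>x. c * f x) = c * bv_minus f"
  by (intro bv_eqI tendsto_mult tendsto_const W21_deriv_tendsto[OF assms(1)])+

text \<open>There is no boundary term at infinity: integrability of q gives p a limit
  \<open>M\<close> there, and integrability of p forces \<open>M = 0\<close>.\<close>

lemma integral_weak_deriv_half_line:
  assumes pq: "weak_deriv_on {0<..} p q" and p: "set_integrable lborel {0<..} p"
    and q: "set_integrable lborel {0<..} q" and L: "(p \<longlongrightarrow> L) (at_right 0)"
  shows "(LINT x:{0<..}|lborel. q x) = - L"
proof -
  have py: "p y = L + (LINT t:{0<..y}|lborel. q t)" if "y > 0" for y
  proof -
    have "set_integrable lborel {0<..y} q"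
      using q by (rule set_integrable_subset) auto
    then have "((\<lambda>x. p y - (LINT t:{x..y}|lborel. q t)) \<longlongrightarrow> p y - (LINT t:{0<..y}|lborel. q t)) (at_right 0)"
      using that by (intro tendsto_diff tendsto_const tendsto_set_lebesgue_integral_at_right) auto
    moreover have "\<forall>\<^sub>F x in at_right 0. p y - (LINT t:{x..y}|lborel. q t) = p x"
      unfolding eventually_at_right_field
      using that by (intro exI[of _ y]) (simp add: weak_deriv_onD(2)[OF pq, symmetric])
    ultimately have "(p \<longlongrightarrow> p y - (LINT t:{0<..y}|lborel. q t)) (at_right 0)"
      by (rule Lim_transform_eventually)
    with L have "L = p y - (LINT t:{0<..y}|lborel. q t)"
      using tendsto_unique[OF trivial_limit_at_right_real] by blast
    then show ?thesis by simp
  qed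
  define M where "M = L + (LINT x:{0<..}|lborel. q x)"
  have "((\<lambda>y. LINT x|lborel. indicator {..y} x *\<^sub>R (indicat_real {0<..} x *\<^sub>R q x)) \<longlongrightarrow> (LINT x:{0<..}|lborel. q x)) at_top"
    unfolding set_lebesgue_integral_def
    by (rule tendsto_integral_at_top) (use q in \<open>auto simp: set_integrable_def\<close>)
  moreover have "(LINT x|lborel. indicator {..y} x *\<^sub>R (indicat_real {0<..} x *\<^sub>R q x)) = (LINT t:{0<..y}|lborel. q t)" for y
    unfolding set_lebesgue_integral_def
    by (rule Bochner_Integration.integral_cong) (auto simp: indicator_def)
  ultimately have "((\<lambda>y. L + (LINT t:{0<..y}|lborel. q t)) \<longlongrightarrow> M) at_top"
    unfolding M_def by (intro tendsto_add tendsto_const) simp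
  moreover have "\<forall>\<^sub>F y in at_top. L + (LINT t:{0<..y}|lborel. q t) = p y"
    using eventually_gt_at_top[of 0] by eventually_elim (simp add: py)
  ultimately have pM: "(p \<longlongrightarrow> M) at_top"
    by (rule Lim_transform_eventually)
  have "M = 0"
  proof (rule ccontr)
    assume "M \<noteq> 0"
    then have "cmod M / 2 < cmod M" by simp
    with tendsto_norm[OF pM] have "\<forall>\<^sub>F y in at_top. cmod M / 2 < cmod (p y)"
      by (rule order_tendstoD)
    then obtain Y where Y: "\<And>y. y \<ge> Y \<Longrightarrow> cmod M / 2 < cmod (p y)"
      unfolding eventually_at_top_linorder by auto
    define Z where "Z = max Y 1"
    define J where "J = (LINT x:{0<..}|lborel. cmod (p x))"
    have le: "r * (cmod M / 2) \<le> J" if "r \<ge> 0" for r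
    proof -
      have "r * (cmod M / 2) = (LINT x|lborel. indicat_real {Z..Z+r} x * (cmod M / 2))"
        using that by simp
      also have "\<dots> \<le> J"
        unfolding J_def set_lebesgue_integral_def
      proof (rule Bochner_Integration.integral_mono)
        show "integrable lborel (\<lambda>x. indicat_real {0<..} x *\<^sub>R cmod (p x))"
          using set_integrable_norm[OF p] unfolding set_integrable_def by simp
        show "integrable lborel (\<lambda>x. indicat_real {Z..Z+r} x * (cmod M / 2))"
          by (intro integrable_mult_left integrable_real_indicator) (auto simp: emeasure_lborel_Icc_eq)
        show "indicat_real {Z..Z+r} x * (cmod M / 2) \<le> indicat_real {0<..} x *\<^sub>R cmod (p x)" for x
          using Y[of x] by (auto simp: indicator_def Z_def)
      qed
      finally show ?thesis .
    qed
    \<comment> \<open>Beyond \<open>Z\<close> the modulus of p exceeds half that of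
      \<open>M\<close>, so an interval of length r contributes at least r |M| / 2 to the integral
      \<open>J\<close>. The length chosen here makes this |J| + 1.\<close>
    from le[of "2 * (\<bar>J\<bar> + 1) / cmod M"] \<open>M \<noteq> 0\<close> show False by simp
  qed
  then show ?thesis unfolding M_def by (simp add: add_eq_0_iff)
qed

lemma LINT_split_half_lines:
  fixes q :: "real \<Rightarrow> complex"
  assumes q: "integrable lborel q"
  shows "(LINT x|lborel. q x) = (LINT x:{0<..}|lborel. q x) + (LINT x:{..<0}|lborel. q x)"
proof -
  have i: "integrable lborel (\<lambda>x. indicat_real {0<..} x *\<^sub>R q x)"
    "integrable lborel (\<lambda>x. indicat_real {..<0} x *\<^sub>R q x)"
    using q by (auto intro!: integrable_mult_indicator)
  show ?thesis
    unfolding set_lebesgue_integral_def Bochner_Integration.integral_add[OF i, symmetric]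
    by (rule LINT_cong_off_0) (auto simp: indicator_def)
qed

lemma integral_weak_deriv_Omega:
  assumes pq: "weak_deriv_Omega p q" and p: "integrable lborel p" and q: "integrable lborel q"
    and L: "(p \<longlongrightarrow> a) (at_right 0)" "(p \<longlongrightarrow> b) (at_left 0)"
  shows "(LINT x|lborel. q x) = b - a"
proof -
  have si: "set_integrable lborel A f" if "integrable lborel f" "A \<in> sets borel" for A and f :: "real \<Rightarrow> complex"
    using that unfolding set_integrable_def by (auto intro!: integrable_mult_indicator)
  have R: "(LINT x:{0<..}|lborel. q x) = - a"
    using pq L p q unfolding weak_deriv_Omega_iff by (intro integral_weak_deriv_half_line[of p]) (auto intro!: si)
  have "uminus ` {..<0::real} = {0<..}" by (auto simp: image_iff intro: bexI[of _ "- x" for x])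
  with pq have "weak_deriv_on {0<..} (\<lambda>x. p (-x)) (\<lambda>x. - q (-x))"
    unfolding weak_deriv_Omega_iff by (metis weak_deriv_on_reflect)
  moreover have "integrable lborel (\<lambda>x. p (-x))" "integrable lborel (\<lambda>x. - q (-x))"
    using lborel_integrable_real_affine[OF p, of "-1" 0] lborel_integrable_real_affine[OF q, of "-1" 0] by auto
  moreover have "((\<lambda>x. p (-x)) \<longlongrightarrow> b) (at_right 0)"
    using L(2) by (simp add: filterlim_at_left_to_right)
  ultimately have "(LINT x:{0<..}|lborel. - q (-x)) = - b"
    by (intro integral_weak_deriv_half_line[of "\<lambda>x. p (-x)"]) (auto intro!: si)
  moreover have "(LINT x:{..<0}|lborel. q x) = (LINT x:{0<..}|lborel. q (-x))"
    unfolding set_lebesgue_integral_def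
    by (subst lborel_integral_real_affine[of "-1" _ 0])
       (auto intro!: Bochner_Integration.integral_cong simp: indicator_def)
  ultimately have "(LINT x:{..<0}|lborel. q x) = b"
    by (simp add: set_lebesgue_integral_def)
  with R show ?thesis using LINT_split_half_lines[OF q] by simp
qed

text \<open>The product of f with the conjugate of g, and its derivative, are built from products of
  L2 functions and so are integrable; only the boundary terms at the origin survive.\<close>

lemma W21_deriv_Green:
  assumes f: "W21_deriv f d" and g: "W21_deriv g e"
  shows "inner_L2 d g + inner_L2 f e = bv_minus f * cnj (bv_minus g) - bv_plus f * cnj (bv_plus g)"
proof -
  note f' = W21_derivD[OF f] and g' = W21_derivD[OF g]
  have "weak_deriv_Omega (\<lambda>x. f x * cnj (g x)) (\<lambda>x. d x * cnj (g x) + f x * cnj (e x))"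
    unfolding weak_deriv_Omega_iff using f' g'
    by (auto intro!: weak_deriv_on_mult weak_deriv_on_cnj simp: is_interval_1)
  moreover have i: "integrable lborel (\<lambda>x. d x * cnj (g x))" "integrable lborel (\<lambda>x. f x * cnj (e x))"
    "integrable lborel (\<lambda>x. f x * cnj (g x))"
    using f' g' by (auto intro!: L2_inner_integrable)
  moreover have "((\<lambda>x. f x * cnj (g x)) \<longlongrightarrow> bv_plus f * cnj (bv_plus g)) (at_right 0)"
    "((\<lambda>x. f x * cnj (g x)) \<longlongrightarrow> bv_minus f * cnj (bv_minus g)) (at_left 0)"
    by (intro tendsto_intros W21_deriv_tendsto[OF f] W21_deriv_tendsto[OF g])+
  ultimately have "(LINT x|lborel. d x * cnj (g x) + f x * cnj (e x))
      = bv_minus f * cnj (bv_minus g) - bv_plus f * cnj (bv_plus g)"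
    by (intro integral_weak_deriv_Omega) auto
  with i show ?thesis unfolding inner_L2_def by simp
qed

subsection \<open>Density and uniqueness of weak derivatives\<close>

text \<open>Real and imaginary parts are approximated separately outside negligible sets; the a.e.
  statement for the completed measure is then pulled back to \<open>lborel\<close>.\<close>

lemma borel_measurable_AE_lim_continuous:
  fixes f :: "real \<Rightarrow> complex"
  assumes [measurable]: "f \<in> borel_measurable borel"
  obtains g where "\<And>n::nat. continuous_on UNIV (g n)" "AE x in lborel. (\<lambda>n. g n x) \<longlonglongrightarrow> f x"
proof -
  have "u measurable_on UNIV" if [measurable]: "u \<in> borel_measurable borel" for u :: "real \<Rightarrow> real"
    by (intro lebesgue_measurable_imp_measurable_on_real measurable_completion) auto
  from this[of "\<lambda>x. Re (f x)"] this[of "\<lambda>x. Im (f x)"] obtain K L :: "real set" and g h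
    where KL: "negligible K" "negligible L" and g: "\<And>n. continuous_on UNIV (g n)"
      "\<And>x. x \<notin> K \<Longrightarrow> (\<lambda>n. g n x) \<longlonglongrightarrow> Re (f x)" and h: "\<And>n. continuous_on UNIV (h n)"
      "\<And>x. x \<notin> L \<Longrightarrow> (\<lambda>n. h n x) \<longlonglongrightarrow> Im (f x)"
    unfolding measurable_on_def by auto
  show ?thesis
  proof
    show "continuous_on UNIV (\<lambda>x. Complex (g n x) (h n x))" for n
      unfolding Complex_eq by (intro continuous_intros g h)
    have "AE x in lebesgue. x \<notin> K \<union> L"
      using KL by (intro AE_not_in) (simp add: negligible_iff_null_sets[symmetric])
    then have "AE x in lebesgue. (\<lambda>n. Complex (g n x) (h n x)) \<longlonglongrightarrow> f x"
    proof eventually_elim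
      case (elim x)
      then have "(\<lambda>n. Complex (g n x) (h n x)) \<longlonglongrightarrow> Complex (Re (f x)) (Im (f x))"
        by (intro tendsto_Complex g(2) h(2)) auto
      then show ?case by simp
    qed
    then show "AE x in lborel. (\<lambda>n. Complex (g n x) (h n x)) \<longlonglongrightarrow> f x"
      by (simp add: AE_completion_iff)
  qed
qed

lemma L2_continuous_compact_support:
  assumes cont: "continuous_on UNIV g" and supp: "\<And>x. x \<notin> {-M..M} \<Longrightarrow> g x = 0"
  shows "g \<in> L2"
proof -
  have "set_integrable lborel {-M..M} (\<lambda>x. (cmod (g x))\<^sup>2)"
    by (intro borel_integrable_atLeastAtMost' continuous_intros continuous_on_subset[OF cont]) auto
  moreover have "indicat_real {-M..M} x *\<^sub>R (cmod (g x))\<^sup>2 = (cmod (g x))\<^sup>2" for x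
    using supp[of x] by (auto simp: indicator_def)
  ultimately have "integrable lborel (\<lambda>x. (cmod (g x))\<^sup>2)"
    by (simp only: set_integrable_def)
  then show ?thesis
    using borel_measurable_continuous_onI[OF cont] unfolding L2_def by simp
qed

text \<open>Squaring removes the kink of the positive part, which makes the cutoff built from it
  continuously differentiable.\<close>

lemma DERIV_max_0_square: "((\<lambda>t::real. (max 0 t)\<^sup>2) has_real_derivative 2 * max 0 t) (at t)"
proof -
  consider "t > 0" | "t < 0" | "t = 0" by linarith
  then show ?thesis
  proof cases
    case 1
    have "((\<lambda>t::real. t\<^sup>2) has_real_derivative 2 * max 0 t) (at t)"
      using 1 by (auto intro!: derivative_eq_intros)
    then show ?thesis
      by (rule has_field_derivative_transform_within_open[of _ _ _ "{0<..}"]) (use 1 in auto)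
  next
    case 2
    have "((\<lambda>t::real. 0) has_real_derivative 2 * max 0 t) (at t)"
      using 2 by (auto intro!: derivative_eq_intros)
    then show ?thesis
      by (rule has_field_derivative_transform_within_open[of _ _ _ "{..<0}"]) (use 2 in auto)
  next
    case 3
    have "((\<lambda>z::real. max 0 z) \<longlongrightarrow> max 0 0) (at 0)"
      by (intro tendsto_intros)
    then have "((\<lambda>z::real. ((max 0 z)\<^sup>2 - (max 0 0)\<^sup>2) / (z - 0)) \<longlongrightarrow> 2 * max 0 0) (at 0)"
      unfolding max.idem mult_zero_right
      by (rule Lim_transform_eventually) (auto intro!: always_eventually simp: max_def power2_eq_square)
    then show ?thesis using 3 by (simp add: has_field_derivative_iff)
  qed
qed

text \<open>The dense family: the factor in front of the polynomial is a C^1 bump supported in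
  \<open>{-M..M}\<close>, so the product is C^1 with compact support, even across the
  origin.\<close>

lemma W21_deriv_cutoff_polynomial:
  fixes p :: "real \<Rightarrow> complex"
  assumes p: "polynomial_function p" and M: "M > 0"
  shows "\<exists>d. W21_deriv (\<lambda>x. of_real ((max 0 (M\<^sup>2 - x\<^sup>2))\<^sup>2) * p x) d"
proof -
  obtain p' where p': "polynomial_function p'" "\<And>x. (p has_vector_derivative (p' x)) (at x)"
    using has_vector_derivative_polynomial_function[OF p] by blast
  define c where "c x = (max 0 (M\<^sup>2 - x\<^sup>2))\<^sup>2" for x :: real
  define c' where "c' x = - 4 * x * max 0 (M\<^sup>2 - x\<^sup>2)" for x :: real
  have "(c has_real_derivative c' x) (at x)" for x
  proof -
    have "((\<lambda>x. M\<^sup>2 - x\<^sup>2) has_real_derivative - 2 * x) (at x)"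
      by (rule derivative_eq_intros refl | simp)+
    then have "(c has_real_derivative 2 * max 0 (M\<^sup>2 - x\<^sup>2) * (- 2 * x)) (at x)"
      unfolding c_def by (rule DERIV_chain2[where f="\<lambda>t. (max 0 t)\<^sup>2", OF DERIV_max_0_square])
    also have "2 * max 0 (M\<^sup>2 - x\<^sup>2) * (- 2 * x) = c' x"
      unfolding c'_def by simp
    finally show ?thesis .
  qed
  then have dc: "((\<lambda>x. complex_of_real (c x)) has_vector_derivative of_real (c' x)) (at x)" for x
    by (intro has_vector_derivative_of_real) (simp add: has_real_derivative_iff_has_vector_derivative)
  have cont: "continuous_on A c" "continuous_on A c'" "continuous_on A p" "continuous_on A p'" for A
    unfolding c_def c'_def
    by (intro continuous_intros continuous_on_polymonial_function[OF p]
        continuous_on_polymonial_function[OF p'(1)])+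
  define d where "d x = of_real (c x) * p' x + of_real (c' x) * p x" for x
  have supp: "c x = 0" "c' x = 0" if "x \<notin> {-M..M}" for x
  proof -
    have "M < \<bar>x\<bar>" using that by auto
    then have "M\<^sup>2 < x\<^sup>2" using M by (metis abs_of_pos abs_le_square_iff linorder_not_le)
    then show "c x = 0" "c' x = 0" unfolding c_def c'_def by auto
  qed
  have "((\<lambda>x. of_real (c x) * p x) has_vector_derivative d x) (at x)" for x
    unfolding d_def by (rule has_vector_derivative_mult[OF dc p'(2)])
  then have "weak_deriv_on S (\<lambda>x. of_real (c x) * p x) d" if "is_interval S" for S
    using that unfolding d_def by (intro weak_deriv_on_C1 continuous_intros cont)
  then have "W21_deriv (\<lambda>x. of_real (c x) * p x) d"
    using supp unfolding d_def
    by (intro W21_derivI L2_continuous_compact_support[where M=M] continuous_intros cont)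
       (auto simp: is_interval_1)
  then show ?thesis unfolding c_def by blast
qed

text \<open>The bump \<open>c\<close> is divided out of f, the quotient is approximated by
  polynomials on the support of the bump, and \<open>c\<close> is multiplied back. Uniform bounds on
  the approximants allow dominated convergence.\<close>

lemma W21_dense_bounded:
  fixes f :: "real \<Rightarrow> complex"
  assumes [measurable]: "f \<in> borel_measurable borel" and bd: "\<And>x. cmod (f x) \<le> N"
    and supp: "\<And>x. \<bar>x\<bar> > N \<Longrightarrow> f x = 0" and e: "e > 0"
  shows "\<exists>\<psi> d. W21_deriv \<psi> d \<and> (LINT x|lborel. (cmod (f x - \<psi> x))\<^sup>2) < e"
proof -
  have N: "N \<ge> 0" using bd[of 0] norm_ge_zero order_trans by blast
  \<comment> \<open>On the set where |x| is at most \<open>N\<close>, the difference of the squares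
    of \<open>M\<close> and x is at least 2 N + 1, so the bump is at least 1 there and dividing f by
    it does not enlarge f.\<close>
  define M where "M = N + 1"
  define c where "c x = (max 0 (M\<^sup>2 - x\<^sup>2))\<^sup>2" for x :: real
  have cM: "0 \<le> c x" "c x \<le> M^4" for x
    unfolding c_def using power_mono[of "max 0 (M\<^sup>2 - x\<^sup>2)" "M\<^sup>2" 2] by auto
  have c0: "c x = 0" if "x \<notin> {-M..M}" for x
  proof -
    have "M < \<bar>x\<bar>" using that by auto
    then have "M\<^sup>2 < x\<^sup>2" using N unfolding M_def
      by (metis abs_le_square_iff abs_of_nonneg add_nonneg_nonneg linorder_not_le zero_le_one)
    then show "c x = 0" unfolding c_def by auto
  qed
  have c1: "c x \<ge> 1" if "\<bar>x\<bar> \<le> N" for x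
  proof -
    have "x\<^sup>2 \<le> N\<^sup>2" using that N by (metis abs_le_square_iff abs_of_nonneg)
    then have "1 \<le> max 0 (M\<^sup>2 - x\<^sup>2)" using N unfolding M_def by (simp add: power2_sum)
    then show ?thesis unfolding c_def by (rule one_le_power)
  qed
  have [measurable]: "c \<in> borel_measurable borel" unfolding c_def by measurable
  define F where "F x = f x / of_real (c x)" for x
  have F [measurable]: "F \<in> borel_measurable borel" unfolding F_def by measurable
  have Fb: "cmod (F x) \<le> N" for x
  proof (cases "\<bar>x\<bar> \<le> N")
    case True
    have "cmod (F x) \<le> cmod (f x) / 1"
      unfolding F_def using c1[OF True] by (simp only: norm_divide norm_of_real) (rule frac_le, auto)
    with bd[of x] show ?thesis by simp
  qed (use N supp in \<open>simp add: F_def\<close>)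
  have cF: "of_real (c x) * F x = f x" for x
    using c1[of x] supp[of x] unfolding F_def by (cases "\<bar>x\<bar> \<le> N") auto
  obtain g where g: "\<And>n::nat. continuous_on UNIV (g n)" "AE x in lborel. (\<lambda>n. g n x) \<longlonglongrightarrow> F x"
    using borel_measurable_AE_lim_continuous[OF F] by blast
  \<comment> \<open>The continuous functions \<open>g n\<close> may be unbounded. The projection
    onto the ball of radius \<open>N\<close> bounds them, is continuous, and fixes the values of
    \<open>F\<close>, so the a.e. limit is kept.\<close>
  define k where "k = closest_point (cball (0::complex) N)"
  have k: "continuous_on UNIV k" unfolding k_def
    using N by (intro continuous_on_closest_point) auto
  have kb: "cmod (k z) \<le> N" for z
    using closest_point_in_set[of "cball (0::complex) N" z] N unfolding k_def by simp
  have kF: "k (F x) = F x" for x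
    unfolding k_def using Fb by (intro closest_point_self) simp
  have "\<exists>p. polynomial_function p \<and> (\<forall>x\<in>{-M..M}. cmod (k (g n x) - p x) < 1 / Suc n)" for n
    using continuous_on_compose2[OF k g(1)]
    by (intro Stone_Weierstrass_polynomial_function) (auto intro: continuous_on_subset)
  then obtain p where p: "\<And>n. polynomial_function (p n)"
    "\<And>n x. x \<in> {-M..M} \<Longrightarrow> cmod (k (g n x) - p n x) < 1 / Suc n"
    by metis
  have [measurable]: "p n \<in> borel_measurable borel" for n
    by (intro borel_measurable_continuous_onI continuous_on_polymonial_function p)
  have pb: "cmod (p n x) \<le> M" if "x \<in> {-M..M}" for n x
  proof -
    have "cmod (p n x) \<le> cmod (k (g n x)) + cmod (k (g n x) - p n x)"
      by (metis norm_minus_commute norm_triangle_sub)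
    also have "\<dots> \<le> N + 1 / Suc n"
      using kb[of "g n x"] p(2)[OF that, of n] by linarith
    also have "\<dots> \<le> M" unfolding M_def by simp
    finally show ?thesis .
  qed
  define h where "h n x = of_real (c x) * p n x" for n x
  have "(\<lambda>n. LINT x|lborel. (cmod (f x - h n x))\<^sup>2) \<longlonglongrightarrow> (LINT x|(lborel :: real measure). (0::real))"
  proof (rule integral_dominated_convergence[where w="\<lambda>x. indicat_real {-M..M} x * (N + M^4 * M)\<^sup>2"])
    show "integrable lborel (\<lambda>x. indicat_real {-M..M} x * (N + M^4 * M)\<^sup>2)"
      by (intro integrable_mult_left integrable_real_indicator) (auto simp: emeasure_lborel_Icc_eq)
    show "(\<lambda>x. (cmod (f x - h n x))\<^sup>2) \<in> borel_measurable lborel" for n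
      unfolding h_def by measurable
    show "AE x in lborel. norm ((cmod (f x - h n x))\<^sup>2) \<le> indicat_real {-M..M} x * (N + M^4 * M)\<^sup>2" for n
    proof (rule AE_I2)
      fix x
      show "norm ((cmod (f x - h n x))\<^sup>2) \<le> indicat_real {-M..M} x * (N + M^4 * M)\<^sup>2"
      proof (cases "x \<in> {-M..M}")
        case True
        have "cmod (h n x) \<le> M^4 * M"
          unfolding h_def using cM pb[OF True] by (simp add: norm_mult mult_mono')
        then have "cmod (f x - h n x) \<le> N + M^4 * M"
          using bd[of x] norm_triangle_ineq4[of "f x" "h n x"] by linarith
        then show ?thesis using True by (auto intro: power_mono)
      next
        case False
        then have "f x = 0" "h n x = 0"
          using c0 supp[of x] unfolding h_def M_def by auto
        then show ?thesis by simp
      qed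
    qed
    show "AE x in lborel. (\<lambda>n. (cmod (f x - h n x))\<^sup>2) \<longlonglongrightarrow> 0"
      using g(2)
    proof eventually_elim
      case (elim x)
      have "(\<lambda>n. h n x) \<longlonglongrightarrow> f x"
      proof (cases "x \<in> {-M..M}")
        case True
        have "(\<lambda>n. k (g n x)) \<longlonglongrightarrow> F x"
          using continuous_on_tendsto_compose[OF k elim] by (simp add: kF)
        moreover have "(\<lambda>n. k (g n x) - p n x) \<longlonglongrightarrow> 0"
          using LIMSEQ_inverse_real_of_nat
          by (rule Lim_null_comparison[rotated])
             (use p(2)[OF True] in \<open>auto intro!: always_eventually less_imp_le simp: inverse_eq_divide\<close>)
        ultimately have "(\<lambda>n. k (g n x) - (k (g n x) - p n x)) \<longlonglongrightarrow> F x - 0"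
          by (rule tendsto_diff)
        then have "(\<lambda>n. h n x) \<longlonglongrightarrow> of_real (c x) * F x"
          unfolding h_def by (intro tendsto_mult tendsto_const) simp
        then show ?thesis by (simp add: cF)
      next
        case False
        then have "f x = 0" "h n x = 0" for n
          using c0 supp[of x] unfolding h_def M_def by auto
        then show ?thesis by simp
      qed
      then have "(\<lambda>n. (cmod (f x - h n x))\<^sup>2) \<longlonglongrightarrow> (cmod (f x - f x))\<^sup>2"
        by (intro tendsto_intros)
      then show ?case by simp
    qed
  qed auto
  then have "\<forall>\<^sub>F n in sequentially. (LINT x|lborel. (cmod (f x - h n x))\<^sup>2) < e"
    using e by (intro order_tendstoD) auto
  then obtain n where "(LINT x|lborel. (cmod (f x - h n x))\<^sup>2) < e"
    using eventually_happens'[OF sequentially_bot] by blast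
  moreover have "\<exists>d. W21_deriv (h n) d"
    using W21_deriv_cutoff_polynomial[OF p(1)[of n], of M] N unfolding h_def c_def M_def by simp
  ultimately show ?thesis by blast
qed

lemma L2_dist_triangle:
  assumes "f \<in> L2" "g \<in> L2" "h \<in> L2"
  shows "(LINT x|lborel. (cmod (f x - h x))\<^sup>2)
    \<le> 2 * (LINT x|lborel. (cmod (f x - g x))\<^sup>2) + 2 * (LINT x|lborel. (cmod (g x - h x))\<^sup>2)"
proof -
  note i = L2_integrable[OF L2_diff]
  have "(LINT x|lborel. (cmod (f x - h x))\<^sup>2)
      \<le> (LINT x|lborel. 2 * (cmod (f x - g x))\<^sup>2 + 2 * (cmod (g x - h x))\<^sup>2)"
    using cmod_add_square_le[of "f x - g x" "g x - h x" for x]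
    by (intro Bochner_Integration.integral_mono i assms Bochner_Integration.integrable_add
        integrable_mult_right) simp
  also have "\<dots> = 2 * (LINT x|lborel. (cmod (f x - g x))\<^sup>2) + 2 * (LINT x|lborel. (cmod (g x - h x))\<^sup>2)"
    using i assms by simp
  finally show ?thesis .
qed

lemma W21_dense:
  assumes f: "f \<in> L2" and e: "e > 0"
  obtains \<psi> d where "W21_deriv \<psi> d" "(LINT x|lborel. (cmod (f x - \<psi> x))\<^sup>2) < e"
proof -
  note [measurable] = L2_measurable[OF f]
  \<comment> \<open>Truncation in the argument and in the value at the same level n, as
    \<open>W21_dense_bounded\<close> asks for. The constant e / 4 used below pays for the factors 2
    in \<open>L2_dist_triangle\<close>.\<close>
  define t where "t n x = (if \<bar>x\<bar> \<le> real n \<and> cmod (f x) \<le> real n then f x else 0)" for n x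
  have [measurable]: "t n \<in> borel_measurable borel" for n
    unfolding t_def by measurable
  have "(\<lambda>n. LINT x|lborel. (cmod (f x - t n x))\<^sup>2) \<longlonglongrightarrow> (LINT x|(lborel :: real measure). (0::real))"
  proof (rule integral_dominated_convergence[where w="\<lambda>x. (cmod (f x))\<^sup>2"])
    show "AE x in lborel. (\<lambda>n. (cmod (f x - t n x))\<^sup>2) \<longlonglongrightarrow> 0"
    proof (rule AE_I2)
      fix x
      obtain n0 where n0: "max \<bar>x\<bar> (cmod (f x)) \<le> real n0" using real_arch_simple by blast
      have "\<forall>\<^sub>F n in sequentially. 0 = (cmod (f x - t n x))\<^sup>2"
        using eventually_ge_at_top[of n0] by eventually_elim (use n0 in \<open>auto simp: t_def\<close>)
      then show "(\<lambda>n. (cmod (f x - t n x))\<^sup>2) \<longlonglongrightarrow> 0"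
        by (rule Lim_transform_eventually[OF tendsto_const])
    qed
  qed (use L2_integrable[OF f] in \<open>auto simp: t_def\<close>)
  then have "\<forall>\<^sub>F n in sequentially. (LINT x|lborel. (cmod (f x - t n x))\<^sup>2) < e / 4"
    using e by (intro order_tendstoD) auto
  then obtain n where n: "(LINT x|lborel. (cmod (f x - t n x))\<^sup>2) < e / 4"
    using eventually_happens'[OF sequentially_bot] by blast
  have "\<exists>\<psi> d. W21_deriv \<psi> d \<and> (LINT x|lborel. (cmod (t n x - \<psi> x))\<^sup>2) < e / 4"
    using e by (intro W21_dense_bounded[of _ "real n"]) (auto simp: t_def)
  then obtain \<psi> d where \<psi>: "W21_deriv \<psi> d" "(LINT x|lborel. (cmod (t n x - \<psi> x))\<^sup>2) < e / 4"
    by blast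
  have "t n \<in> L2"
    by (rule L2_bound[OF f, where C=1]) (auto simp: t_def)
  from L2_dist_triangle[OF f this W21_derivD(1)[OF \<psi>(1)]] n \<psi>
  show ?thesis by (intro that[OF \<psi>(1)]) linarith
qed

text \<open>If psi approximates e with squared error below \<delta>, orthogonality gives |e|^2 = <e,
  e - psi>, which is at most (|e|^2 + \<delta>) / 2; hence |e|^2 is at most \<delta>.\<close>

lemma L2_orthogonal_W21:
  assumes e: "e \<in> L2" and orth: "\<And>\<psi> d. W21_deriv \<psi> d \<Longrightarrow> inner_L2 e \<psi> = 0"
  shows "AE x in lborel. e x = 0"
proof -
  let ?n = "LINT x|lborel. (cmod (e x))\<^sup>2"
  have "?n \<le> \<delta>" if "\<delta> > 0" for \<delta>
  proof -
    obtain \<psi> d where \<psi>: "W21_deriv \<psi> d" "(LINT x|lborel. (cmod (e x - \<psi> x))\<^sup>2) < \<delta>"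
      using W21_dense[OF e \<open>\<delta> > 0\<close>] .
    note \<psi>' = W21_derivD(1)[OF \<psi>(1)]
    have "complex_of_real ?n = inner_L2 e (\<lambda>x. e x - \<psi> x)"
      using orth[OF \<psi>(1)] e \<psi>' by (simp add: inner_L2_diff_right inner_L2_self)
    moreover have "?n \<le> cmod (complex_of_real ?n)"
      by (simp only: norm_of_real abs_ge_self)
    ultimately have "?n \<le> cmod (inner_L2 e (\<lambda>x. e x - \<psi> x))"
      by simp
    with inner_L2_le[OF e L2_diff[OF e \<psi>'], of 1] \<psi>(2) show ?thesis by simp
  qed
  then have "?n \<le> 0" by (rule field_le_epsilon) simp
  then have "?n = 0" by (intro antisym) auto
  then show ?thesis by (rule L2_AE_zero[OF e])
qed

text \<open>The difference of the two derivatives is a weak derivative of the zero function, so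
  Green's identity makes it orthogonal to the dense class.\<close>

lemma W21_deriv_unique:
  assumes "W21_deriv f d" "W21_deriv f d'"
  shows "AE x in lborel. d x = d' x"
proof -
  have 0: "W21_deriv (\<lambda>x. 0) (\<lambda>x. d x - d' x)"
    using W21_deriv_add[OF assms(1) W21_deriv_cmult[OF assms(2), of "-1"]] by simp
  have b: "bv_plus (\<lambda>x. 0) = 0" "bv_minus (\<lambda>x. 0) = 0"
    by (intro bv_eqI tendsto_const)+
  have "AE x in lborel. d x - d' x = 0"
  proof (rule L2_orthogonal_W21[OF W21_derivD(2)[OF 0]])
    fix \<psi> e assume "W21_deriv \<psi> e"
    from W21_deriv_Green[OF 0 this] show "inner_L2 (\<lambda>x. d x - d' x) \<psi> = 0"
      by (simp add: b inner_L2_def[of "\<lambda>x. 0"])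
  qed
  then show ?thesis by simp
qed

lemma AE_Wderiv: "W21_deriv f d \<Longrightarrow> AE x in lborel. Wderiv f x = d x"
  using W21_deriv_unique[OF W21_deriv_Wderiv] W21_Omega_iff by blast

subsection \<open>The unperturbed resolvent\<close>

lemma gz_eq: "gz z x = (if x * Im z < 0 then \<i> * of_real (sgn (Im z)) * exp (- \<i> * z * of_real x) else 0)"
  unfolding gz_def heaviside_def by auto

lemma cmod_gz: "cmod (gz z x) = (if x * Im z < 0 then exp (Im z * x) else 0)"
  by (auto simp: gz_eq norm_mult norm_exp_eq_Re sgn_if)

lemma gz_measurable [measurable]: "gz z \<in> borel_measurable borel"
proof -
  have [measurable]: "(\<lambda>x. exp (- \<i> * z * complex_of_real x)) \<in> borel_measurable borel"
    by (intro borel_measurable_continuous_onI continuous_intros)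
  have "(\<lambda>x. if x * Im z < 0 then \<i> * of_real (sgn (Im z)) * exp (- \<i> * z * of_real x) else 0) \<in> borel_measurable borel"
    by measurable
  then show ?thesis unfolding gz_eq[abs_def] .
qed

text \<open>Exchanges the two half-planes, so that the kernel needs to be integrated only for
  negative imaginary part.\<close>

lemma gz_uminus: "gz z (- x) = - gz (- z) x"
  by (simp add: gz_eq sgn_minus)

lemma has_bochner_integral_cmod_gz:
  assumes z: "Im z \<noteq> 0"
  shows "has_bochner_integral lborel (\<lambda>x. cmod (gz z x)) (1 / \<bar>Im z\<bar>)"
proof -
  have neg: "has_bochner_integral lborel (\<lambda>x. cmod (gz w x)) (1 / \<bar>Im w\<bar>)" if w: "Im w < 0" for w
  proof (rule has_bochner_integral_nn_integral)
    define F where "F x = exp (Im w * x) / Im w" for x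
    have "(\<integral>\<^sup>+x. ennreal (exp (Im w * x)) * indicator {0..} x \<partial>lborel) = ennreal (0 - F 0)"
    proof (rule nn_integral_FTC_atLeast)
      show "DERIV F x :> exp (Im w * x)" for x
        unfolding F_def using w by (auto intro!: derivative_eq_intros)
      have "((\<lambda>x. exp (Im w * x)) \<longlongrightarrow> 0) at_top"
        by (intro filterlim_compose[OF exp_at_bot] filterlim_tendsto_neg_mult_at_bot[OF tendsto_const w filterlim_ident])
      from tendsto_divide[OF this tendsto_const, of "Im w"] show "(F \<longlongrightarrow> 0) at_top"
        unfolding F_def using w by simp
    qed auto
    moreover have "(\<integral>\<^sup>+x. ennreal (cmod (gz w x)) \<partial>lborel)
        = (\<integral>\<^sup>+x. ennreal (exp (Im w * x)) * indicator {0..} x \<partial>lborel)"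
      using w by (intro nn_integral_cong_AE AE_off_0) (auto simp: cmod_gz indicator_def mult_less_0_iff)
    ultimately show "(\<integral>\<^sup>+x. ennreal (cmod (gz w x)) \<partial>lborel) = ennreal (1 / \<bar>Im w\<bar>)"
      using w unfolding F_def by simp
  qed (use w in auto)
  show ?thesis
  proof (cases "Im z < 0")
    case False
    then have "has_bochner_integral lborel (\<lambda>x. cmod (gz (-z) (0 + (-1) * x))) ((1 / \<bar>Im (-z)\<bar>) /\<^sub>R \<bar>-1\<bar>)"
      using z by (intro lborel_has_bochner_integral_real_affine_iff[THEN iffD1] neg) auto
    then show ?thesis by (simp add: gz_uminus)
  qed (rule neg)
qed

lemmas integrable_cmod_gz = has_bochner_integral_cmod_gz[THEN has_bochner_integral_iff[THEN iffD1], THEN conjunct1]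
lemmas LINT_cmod_gz = has_bochner_integral_cmod_gz[THEN has_bochner_integral_iff[THEN iffD1], THEN conjunct2]

text \<open>Turns the L2 norm of the kernel into the L1 norm of the kernel at 2 z.\<close>

lemma cmod_gz_square: "(cmod (gz z x))\<^sup>2 = cmod (gz (2 * z) x)"
  by (auto simp: cmod_gz exp_double[symmetric] mult_less_0_iff mult.assoc)

lemma gz_L2: "Im z \<noteq> 0 \<Longrightarrow> gz z \<in> L2"
  using integrable_cmod_gz[of "2 * z"] unfolding L2_def by (simp add: cmod_gz_square)

lemma LINT_gz_square: "Im z \<noteq> 0 \<Longrightarrow> (LINT x|lborel. (cmod (gz z x))\<^sup>2) = 1 / (2 * \<bar>Im z\<bar>)"
  using LINT_cmod_gz[of "2 * z"] by (simp add: cmod_gz_square abs_mult)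

lemma gz_reflect_L2:
  assumes "Im z \<noteq> 0"
  shows "(\<lambda>y. gz z (x - y)) \<in> L2"
proof -
  have "integrable lborel (\<lambda>y. (cmod (gz z (x + (-1) * y)))\<^sup>2)"
    by (rule lborel_integrable_real_affine[OF L2_integrable[OF gz_L2[OF assms]]]) simp
  then show ?thesis unfolding L2_def by simp
qed

lemma gz_kernel_integrable: "Im z \<noteq> 0 \<Longrightarrow> h \<in> L2 \<Longrightarrow> integrable lborel (\<lambda>y. gz z (x - y) * h y)"
  by (intro L2_mult_integrable gz_reflect_L2)

section \<open>L2 boundedness and differential equation of the free resolvent\<close>

definition free_resolvent :: "complex \<Rightarrow> (real \<Rightarrow> complex) \<Rightarrow> real \<Rightarrow> complex" where
  "free_resolvent z h x = (LINT y|lborel. gz z (x - y) * h y)"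

lemma cmod_free_resolvent_square_le:
  assumes z: "Im z \<noteq> 0" and h: "h \<in> L2"
  shows "(cmod (free_resolvent z h x))\<^sup>2
    \<le> (LINT y|lborel. cmod (gz z (x - y)) * (cmod (h y))\<^sup>2) / \<bar>Im z\<bar>"
proof -
  note [measurable] = L2_measurable[OF h]
  define a where "a = \<bar>Im z\<bar>"
  have a: "a > 0" using z unfolding a_def by simp
  define k where "k y = cmod (gz z (x - y))" for y
  have k: "integrable lborel k" "(LINT y|lborel. k y) = 1 / a"
    using lborel_integrable_real_affine[OF integrable_cmod_gz[OF z], of "-1" x]
      lborel_integral_real_affine[of "-1" "\<lambda>y. cmod (gz z y)" x] LINT_cmod_gz[OF z]
    unfolding k_def a_def by simp_all
  have [measurable]: "k \<in> borel_measurable borel" using k(1) by simp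
  have k1: "0 \<le> k y" "k y \<le> 1" for y
    unfolding k_def by (auto simp: cmod_gz mult.commute)
  have i1: "integrable lborel (\<lambda>y. k y * cmod (h y))"
    using integrable_norm[OF gz_kernel_integrable[OF z h, of x]] unfolding k_def by (simp add: norm_mult)
  have i2: "integrable lborel (\<lambda>y. k y * (cmod (h y))\<^sup>2)"
    by (rule Bochner_Integration.integrable_bound[OF L2_integrable[OF h]])
       (use k1 in \<open>auto simp: mult_left_le_one_le\<close>)
  define m where "m = (LINT y|lborel. k y * cmod (h y))"
  define V where "V = (LINT y|lborel. k y * (cmod (h y))\<^sup>2)"
  \<comment> \<open>Cauchy--Schwarz, obtained from the nonnegativity of the variance of \<open>cmod \<circ> h\<close> with respect to the density \<open>a * k\<close>.\<close>
  have eq: "k y * (cmod (h y) - a * m)\<^sup>2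
      = k y * (cmod (h y))\<^sup>2 - 2 * a * m * (k y * cmod (h y)) + (a * m)\<^sup>2 * k y" for y
    by (simp add: power2_diff algebra_simps)
  have "0 \<le> (LINT y|lborel. k y * (cmod (h y) - a * m)\<^sup>2)"
    using k1 by (intro Bochner_Integration.integral_nonneg) simp
  also have "\<dots> = V - 2 * a * m * m + (a * m)\<^sup>2 * (1 / a)"
    unfolding eq using i1 i2 k by (simp add: m_def V_def)
  also have "\<dots> = V - a * m\<^sup>2"
    using a by (simp add: power2_eq_square)
  finally have "m\<^sup>2 \<le> V / a" using a by (simp add: field_simps)
  moreover have "cmod (free_resolvent z h x) \<le> m"
    using integral_norm_bound[of lborel "\<lambda>y. gz z (x - y) * h y"]
    unfolding free_resolvent_def m_def k_def by (simp add: norm_mult)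
  then have "(cmod (free_resolvent z h x))\<^sup>2 \<le> m\<^sup>2" by (rule power_mono) simp
  ultimately show ?thesis unfolding V_def k_def a_def by linarith
qed

text \<open>Schur's test: the pointwise bound is integrated in x and the order of integration
  exchanged; the kernel has L1 norm 1 / |Im z| in either variable.\<close>

lemma free_resolvent_L2:
  assumes z: "Im z \<noteq> 0" and h: "h \<in> L2"
  shows "free_resolvent z h \<in> L2"
proof -
  note [measurable] = L2_measurable[OF h]
  have [measurable]: "free_resolvent z h \<in> borel_measurable borel"
    unfolding free_resolvent_def[abs_def] by measurable
  have i: "integrable lborel (\<lambda>x. cmod (gz z (x - y)))" for y
    using lborel_integrable_real_affine[OF integrable_cmod_gz[OF z], of 1 "-y"] by simp
  have e: "(LINT x|lborel. cmod (gz z (x - y))) = 1 / \<bar>Im z\<bar>" for y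
    using lborel_integral_real_affine[of 1 "\<lambda>y. cmod (gz z y)" "-y"] LINT_cmod_gz[OF z] by simp
  have "integrable (lborel \<Otimes>\<^sub>M lborel) (\<lambda>(y, x). cmod (gz z (x - y)) * (cmod (h y))\<^sup>2)"
  proof (rule lborel_pair.Fubini_integrable)
    show "integrable lborel (\<lambda>y. LINT x|lborel. norm (case (y, x) of (y, x) \<Rightarrow> cmod (gz z (x - y)) * (cmod (h y))\<^sup>2))"
      using L2_integrable[OF h] by (simp add: abs_mult e)
  qed (auto intro!: i)
  then have "integrable lborel (\<lambda>x. LINT y|lborel. cmod (gz z (x - y)) * (cmod (h y))\<^sup>2)"
    by (rule lborel_pair.integrable_snd)
  then have "integrable lborel (\<lambda>x. (LINT y|lborel. cmod (gz z (x - y)) * (cmod (h y))\<^sup>2) / \<bar>Im z\<bar>)"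
    by simp
  then have "integrable lborel (\<lambda>x. (cmod (free_resolvent z h x))\<^sup>2)"
    by (rule Bochner_Integration.integrable_bound)
       (use cmod_free_resolvent_square_le[OF z h] in auto)
  then show ?thesis unfolding L2_def by simp
qed

lemma exp_weak_deriv_on:
  "is_interval S \<Longrightarrow> weak_deriv_on S (\<lambda>x. exp (- \<i> * z * of_real x)) (\<lambda>x. - \<i> * z * exp (- \<i> * z * of_real x))"
proof (rule weak_deriv_on_C1)
  fix x :: real
  have "((\<lambda>w. exp (- \<i> * z * w)) has_field_derivative - \<i> * z * exp (- \<i> * z * of_real x)) (at (of_real x))"
    by (auto intro!: derivative_eq_intros)
  from has_vector_derivative_real_field[OF this]
  show "((\<lambda>x. exp (- \<i> * z * complex_of_real x)) has_vector_derivative - \<i> * z * exp (- \<i> * z * of_real x)) (at x)"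
    by simp
qed (auto intro!: continuous_intros)

text \<open>The kernel factors as \<open>e x * (q x y / e y)\<close> with a step function
  \<open>q\<close>. Pulling out \<open>e x\<close> leaves a function \<open>P\<close> that is a
  primitive of -i h / e, and the product rule yields the equation.\<close>

lemma free_resolvent_weak_deriv:
  assumes z: "Im z \<noteq> 0" and h: "h \<in> L2"
  shows "weak_deriv_on UNIV (free_resolvent z h) (\<lambda>x. - \<i> * (h x + z * free_resolvent z h x))"
proof -
  define e where "e x = exp (- \<i> * z * of_real x)" for x :: real
  have e0: "e x \<noteq> 0" for x unfolding e_def by simp
  define q where "q x y = (if (x - y) * Im z < 0 then \<i> * of_real (sgn (Im z)) else 0)" for x y
  have "exp (- \<i> * z * of_real (x - y)) = e x / e y" for x y
    unfolding e_def exp_diff[symmetric] by (simp add: algebra_simps)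
  then have gq: "gz z (x - y) = e x * (q x y / e y)" for x y
    unfolding gz_eq q_def by simp
  define P where "P x = (LINT y|lborel. q x y / e y * h y)" for x
  have int: "integrable lborel (\<lambda>y. q x y / e y * h y)" for x
  proof -
    have "integrable lborel (\<lambda>y. inverse (e x) * (gz z (x - y) * h y))"
      by (intro integrable_mult_right gz_kernel_integrable z h)
    then show ?thesis unfolding gq using e0 by (simp add: field_simps)
  qed
  have uP: "free_resolvent z h x = e x * P x" for x
    unfolding free_resolvent_def gq P_def by (simp only: mult.assoc integral_mult_right_zero)
  have "weak_deriv_on UNIV P (\<lambda>y. - \<i> / e y * h y)"
    unfolding weak_deriv_on_def
  proof (intro ballI impI)
    fix x x' :: real assume xx': "x \<le> x'"
    have eq: "q x' y / e y * h y - q x y / e y * h y = indicat_real {x..x'} y *\<^sub>R (- \<i> / e y * h y)"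
      if "y \<notin> {x, x'}" for y
    proof -
      \<comment> \<open>Whichever sign Im z has, moving x past y changes the step by -i. The
        endpoints are excluded because the strict inequality in \<open>q\<close> can break the
        identity at one of them.\<close>
      have "q x' y - q x y = indicat_real {x..x'} y *\<^sub>R (- \<i>)"
        using that xx' z unfolding q_def indicator_def by (auto simp: mult_less_0_iff sgn_if)
      moreover have "q x' y / e y * h y - q x y / e y * h y = (q x' y - q x y) * (h y / e y)"
        by (simp add: algebra_simps diff_divide_distrib)
      ultimately show ?thesis by (simp add: scaleR_conv_of_real)
    qed
    have "integrable lborel (\<lambda>y. q x' y / e y * h y - q x y / e y * h y)"
      by (intro Bochner_Integration.integrable_diff int)
    then have i: "integrable lborel (\<lambda>y. indicat_real {x..x'} y *\<^sub>R (- \<i> / e y * h y))"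
      by (rule integrable_discrete_difference[THEN iffD1, rotated -1, where X1="{x, x'}"]) (use eq in auto)
    have "P x' - P x = (LINT y|lborel. q x' y / e y * h y - q x y / e y * h y)"
      unfolding P_def by (rule Bochner_Integration.integral_diff[symmetric, OF int int])
    also have "\<dots> = (LINT y|lborel. indicat_real {x..x'} y *\<^sub>R (- \<i> / e y * h y))"
      by (rule integral_discrete_difference[where X="{x, x'}"]) (use eq in auto)
    finally show "set_integrable lborel {x..x'} (\<lambda>y. - \<i> / e y * h y) \<and>
        P x' - P x = (LINT y:{x..x'}|lborel. - \<i> / e y * h y)"
      using i unfolding set_integrable_def set_lebesgue_integral_def by simp
  qed
  from weak_deriv_on_mult[OF _ exp_weak_deriv_on[of UNIV z] this]
  have "weak_deriv_on UNIV (\<lambda>x. e x * P x) (\<lambda>x. - \<i> * z * e x * P x + e x * (- \<i> / e x * h x))"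
    unfolding e_def by simp
  then show ?thesis
    by (rule weak_deriv_on_cong) (use e0 in \<open>auto simp: uP field_simps\<close>)
qed

section \<open>Gauge transform, the unperturbed kernel and the functions E_1 and E_2\<close>

definition phase :: "real \<Rightarrow> real \<Rightarrow> complex" where
  "phase \<alpha> x = (if x > 0 then exp (\<i> * of_real \<alpha>) else 1)"

lemma cmod_phase [simp]: "cmod (phase \<alpha> x) = 1"
  by (simp add: phase_def norm_exp_eq_Re)

lemma phase_mult_cnj [simp]: "phase \<alpha> x * cnj (phase \<alpha> x) = 1" "cnj (phase \<alpha> x) * phase \<alpha> x = 1"
  using complex_norm_square[of "phase \<alpha> x"] by (simp_all add: mult.commute)

lemma phase_measurable [measurable]: "phase \<alpha> \<in> borel_measurable borel"
  unfolding phase_def[abs_def] by measurable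

lemma phase_L2: "f \<in> L2 \<Longrightarrow> (\<lambda>x. phase \<alpha> x * f x) \<in> L2"
  by (rule L2_bound[where C=1 and f=f]) (auto simp: norm_mult intro!: borel_measurable_times L2_measurable)

lemma cnj_phase_L2: "f \<in> L2 \<Longrightarrow> (\<lambda>x. cnj (phase \<alpha> x) * f x) \<in> L2"
  using phase_L2[of f "- \<alpha>"] by (simp add: phase_def exp_cnj if_distrib cong: if_cong)

text \<open>Being constant on each half-line, the phase commutes with differentiation there; at the
  origin it turns continuity into the boundary condition of the unperturbed operator.\<close>

lemma W21_deriv_phase:
  assumes "W21_deriv f d"
  shows "W21_deriv (\<lambda>x. phase \<alpha> x * f x) (\<lambda>x. phase \<alpha> x * d x)"
    "bv_plus (\<lambda>x. phase \<alpha> x * f x) = exp (\<i> * of_real \<alpha>) * bv_plus f"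
    "bv_minus (\<lambda>x. phase \<alpha> x * f x) = bv_minus f"
proof -
  note f = W21_derivD[OF assms]
  show "W21_deriv (\<lambda>x. phase \<alpha> x * f x) (\<lambda>x. phase \<alpha> x * d x)"
  proof (rule W21_derivI)
    show "weak_deriv_on {0<..} (\<lambda>x. phase \<alpha> x * f x) (\<lambda>x. phase \<alpha> x * d x)"
      by (rule weak_deriv_on_cong[OF weak_deriv_on_cmult[OF f(3), of "exp (\<i> * of_real \<alpha>)"]])
         (simp_all add: phase_def is_interval_1)
    show "weak_deriv_on {..<0} (\<lambda>x. phase \<alpha> x * f x) (\<lambda>x. phase \<alpha> x * d x)"
      by (rule weak_deriv_on_cong[OF f(4)]) (simp_all add: phase_def is_interval_1)
  qed (intro phase_L2 f)+
  show "bv_plus (\<lambda>x. phase \<alpha> x * f x) = exp (\<i> * of_real \<alpha>) * bv_plus f"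
    by (rule bv_eqI, rule Lim_transform_eventually[OF tendsto_mult[OF tendsto_const W21_deriv_tendsto(1)[OF assms]]])
       (simp add: eventually_at_filter phase_def)
  show "bv_minus (\<lambda>x. phase \<alpha> x * f x) = bv_minus f"
    by (rule bv_eqI, rule Lim_transform_eventually[OF W21_deriv_tendsto(2)[OF assms]])
       (simp add: eventually_at_filter phase_def)
qed

lemma gz_tendsto:
  assumes z: "Im z \<noteq> 0"
  shows "(gz z \<longlongrightarrow> (if Im z < 0 then - \<i> else 0)) (at_right 0)"
    "(gz z \<longlongrightarrow> (if Im z > 0 then \<i> else 0)) (at_left 0)"
proof -
  have e: "((\<lambda>x. c * exp (- \<i> * z * complex_of_real x)) \<longlongrightarrow> c) F" if "F \<le> at 0" for c F
  proof -
    have "isCont (\<lambda>x. c * exp (- \<i> * z * complex_of_real x)) 0"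
      by (intro continuous_intros)
    then show ?thesis using that unfolding isCont_def by (auto intro: tendsto_mono)
  qed
  show "(gz z \<longlongrightarrow> (if Im z < 0 then - \<i> else 0)) (at_right 0)"
    by (rule Lim_transform_eventually[OF e]) 
       (use z in \<open>auto simp: at_le eventually_at_filter gz_eq mult_less_0_iff\<close>)
  show "(gz z \<longlongrightarrow> (if Im z > 0 then \<i> else 0)) (at_left 0)"
    by (rule Lim_transform_eventually[OF e]) 
       (use z in \<open>auto simp: at_le eventually_at_filter gz_eq mult_less_0_iff\<close>)
qed

lemma gz_W21_deriv:
  assumes z: "Im z \<noteq> 0"
  shows "W21_deriv (gz z) (\<lambda>x. - \<i> * (z * gz z x))"
proof -
  have w: "weak_deriv_on S (gz z) (\<lambda>x. - \<i> * (z * gz z x))"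
    if "is_interval S" "\<And>x. x \<in> S \<Longrightarrow> gz z x = c * exp (- \<i> * z * of_real x)" for S c
    by (rule weak_deriv_on_cong[OF weak_deriv_on_cmult[OF exp_weak_deriv_on, of S c z]])
       (simp_all add: that)
  have "weak_deriv_on {0<..} (gz z) (\<lambda>x. - \<i> * (z * gz z x))"
    by (rule w[of _ "if Im z < 0 then - \<i> else 0"])
       (use z in \<open>auto simp: gz_eq mult_less_0_iff is_interval_1\<close>)
  moreover have "weak_deriv_on {..<0} (gz z) (\<lambda>x. - \<i> * (z * gz z x))"
    by (rule w[of _ "if Im z > 0 then \<i> else 0"])
       (use z in \<open>auto simp: gz_eq mult_less_0_iff is_interval_1\<close>)
  ultimately show ?thesis
    by (intro W21_derivI L2_cmult gz_L2 z)
qed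

text \<open>The equation holds on the whole line, so the free resolvent is continuous at 0 and both
  one-sided limits agree with its value.\<close>

lemma free_resolvent_W21_deriv:
  assumes z: "Im z \<noteq> 0" and h: "h \<in> L2"
  shows "W21_deriv (free_resolvent z h) (\<lambda>x. - \<i> * (h x + z * free_resolvent z h x))"
    "bv_plus (free_resolvent z h) = free_resolvent z h 0"
    "bv_minus (free_resolvent z h) = free_resolvent z h 0"
proof -
  note w = free_resolvent_weak_deriv[OF z h]
  show "W21_deriv (free_resolvent z h) (\<lambda>x. - \<i> * (h x + z * free_resolvent z h x))"
    by (intro W21_derivI L2_cmult L2_add h free_resolvent_L2 z weak_deriv_on_subset[OF w]) auto
  have "continuous_on {-1..1} (free_resolvent z h)"
    by (rule weak_deriv_on_continuous[OF w]) simp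
  then have "isCont (free_resolvent z h) 0"
    by (rule continuous_on_interior) simp
  then have lim: "(free_resolvent z h \<longlongrightarrow> free_resolvent z h 0) (at 0)"
    unfolding isCont_def .
  show "bv_plus (free_resolvent z h) = free_resolvent z h 0"
    by (rule bv_eqI(1)[OF tendsto_mono[OF at_le lim]]) simp
  show "bv_minus (free_resolvent z h) = free_resolvent z h 0"
    by (rule bv_eqI(2)[OF tendsto_mono[OF at_le lim]]) simp
qed

text \<open>For x, y on the same side the phases cancel and the rank-one term vanishes. That term
  lives where x Im z < 0 < y Im z; there the exponentials combine to one in x - y, and
  \<open>beta\<close> changes the coefficient i to i exp(-i \<alpha>) for Im z > 0, and -i to -i
  exp(i \<alpha>) for Im z < 0. On the remaining pairs of opposite sides both sides are 0.\<close>

lemma G0_eq: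
  assumes z: "Im z \<noteq> 0" and x: "x \<noteq> 0" and y: "y \<noteq> 0"
  shows "G0 z x y \<alpha> = phase \<alpha> x * gz z (x - y) * cnj (phase \<alpha> y)"
proof -
  have e: "exp (- \<i> * z * of_real x) * exp (\<i> * z * of_real y) = exp (- \<i> * z * of_real (x - y))"
    by (simp add: exp_add[symmetric] algebra_simps)
  have a: "exp (\<i> * of_real \<alpha>) * exp (- \<i> * of_real \<alpha>) = 1"
    by (simp add: exp_add[symmetric])
  have cg: "cnj (gz (cnj z) y) = (if y * Im z > 0 then \<i> * of_real (sgn (Im z)) * exp (\<i> * z * of_real y) else 0)"
    by (auto simp: gz_eq exp_cnj sgn_minus)
  have p: "gz z x * b * cnj (gz (cnj z) y) = (if x * Im z < 0 \<and> y * Im z > 0 then - b * exp (- \<i> * z * of_real (x - y)) else 0)" for b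
    unfolding cg gz_eq[of z x] e[symmetric] using z by (auto simp: sgn_if algebra_simps)
  have s: "x * Im z < 0 \<and> y * Im z > 0 \<longrightarrow> (x - y) * Im z < 0"
    by (auto simp: left_diff_distrib)
  show ?thesis
    unfolding G0_def p gz_eq[of z "x - y"] beta_def heaviside_def phase_def
    using x y z s a
    by (auto simp: sgn_if exp_cnj mult_less_0_iff zero_less_mult_iff algebra_simps)
qed

text \<open>For fixed nonzero x and y close to 0, x - y has the sign of x, so the cutoff in the
  kernel is locally constant in y and the limit passes through the exponential. For y < 0 the second
  phase is 1.\<close>

lemma E_1_eq:
  assumes z: "Im z \<noteq> 0" and x: "x \<noteq> 0"
  shows "E v \<alpha> 1 x z = phase \<alpha> x * gz z x"
proof -
  have "\<forall>\<^sub>F y in at_left 0. (x * Im z < 0 \<longleftrightarrow> (x - y) * Im z < 0)"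
  proof -
    have "((\<lambda>y. (x - y) * Im z) \<longlongrightarrow> (x - 0) * Im z) (at_left 0)"
      by (intro tendsto_intros)
    then have lim: "((\<lambda>y. (x - y) * Im z) \<longlongrightarrow> x * Im z) (at_left 0)" by simp
    have "x * Im z < 0 \<or> 0 < x * Im z"
      using z x by (metis mult_eq_0_iff neq_iff)
    then show ?thesis
    proof
      assume neg: "x * Im z < 0"
      from order_tendstoD(2)[OF lim neg] show ?thesis
        by eventually_elim (use neg in simp)
    next
      assume pos: "0 < x * Im z"
      from order_tendstoD(1)[OF lim pos] show ?thesis
        by eventually_elim (use pos in simp)
    qed
  qed
  moreover have "\<forall>\<^sub>F y in at_left (0::real). y < 0" by (simp add: eventually_at_filter)
  ultimately have ev: "\<forall>\<^sub>F y in at_left 0. phase \<alpha> x * (if x * Im z < 0 then \<i> * of_real (sgn (Im z)) * exp (- \<i> * z * of_real (x - y)) else 0) = G0 z x y \<alpha>"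
    by eventually_elim (use z x in \<open>auto simp: G0_eq gz_eq phase_def\<close>)
  have "((\<lambda>y. phase \<alpha> x * (if x * Im z < 0 then \<i> * of_real (sgn (Im z)) * exp (- \<i> * z * of_real (x - y)) else 0))
     \<longlongrightarrow> phase \<alpha> x * (if x * Im z < 0 then \<i> * of_real (sgn (Im z)) * exp (- \<i> * z * of_real (x - 0)) else 0)) (at_left 0)"
    by (cases "x * Im z < 0") (simp_all only: if_True if_False, (intro tendsto_intros)+)
  from Lim_transform_eventually[OF this ev]
  have "((\<lambda>y. G0 z x y \<alpha>) \<longlongrightarrow> phase \<alpha> x * gz z x) (at_left 0)"
    unfolding gz_eq by (simp only: diff_zero)
  then show ?thesis unfolding E_def by (simp add: tendsto_Lim)
qed

definition resolvent0 :: "complex \<Rightarrow> real \<Rightarrow> (real \<Rightarrow> complex) \<Rightarrow> real \<Rightarrow> complex" where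
  "resolvent0 z \<alpha> f x = phase \<alpha> x * free_resolvent z (\<lambda>y. cnj (phase \<alpha> y) * f y) x"

lemma LINT_G0:
  assumes z: "Im z \<noteq> 0" and x: "x \<noteq> 0" and f: "f \<in> L2"
  shows "integrable lborel (\<lambda>y. G0 z x y \<alpha> * f y)" "(LINT y|lborel. G0 z x y \<alpha> * f y) = resolvent0 z \<alpha> f x"
proof -
  have eq: "G0 z x y \<alpha> * f y = phase \<alpha> x * (gz z (x - y) * (cnj (phase \<alpha> y) * f y))" if "y \<noteq> 0" for y
    using that z x by (simp add: G0_eq)
  have "integrable lborel (\<lambda>y. phase \<alpha> x * (gz z (x - y) * (cnj (phase \<alpha> y) * f y)))"
    by (intro integrable_mult_right gz_kernel_integrable z cnj_phase_L2 f)
  then show "integrable lborel (\<lambda>y. G0 z x y \<alpha> * f y)"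
    by (rule integrable_discrete_difference[THEN iffD2, rotated -1, where X1="{0}"]) (use eq in auto)
  show "(LINT y|lborel. G0 z x y \<alpha> * f y) = resolvent0 z \<alpha> f x"
    using LINT_cong_off_0[of "\<lambda>y. G0 z x y \<alpha> * f y", OF eq]
    unfolding resolvent0_def free_resolvent_def by simp
qed

lemma E_2_eq:
  assumes z: "Im z \<noteq> 0" and x: "x \<noteq> 0" and v: "v \<in> L2"
  shows "E v \<alpha> 2 x z = resolvent0 z \<alpha> v x"
  using LINT_G0(2)[OF assms] by (simp add: E_def)

lemma resolvent0_W21_deriv:
  assumes z: "Im z \<noteq> 0" and f: "f \<in> L2"
  shows "W21_deriv (resolvent0 z \<alpha> f) (\<lambda>x. - \<i> * (f x + z * resolvent0 z \<alpha> f x))"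
    "bv_plus (resolvent0 z \<alpha> f) = exp (\<i> * of_real \<alpha>) * bv_minus (resolvent0 z \<alpha> f)"
    "bv_minus (resolvent0 z \<alpha> f) = free_resolvent z (\<lambda>y. cnj (phase \<alpha> y) * f y) 0"
proof -
  note S = free_resolvent_W21_deriv[OF z cnj_phase_L2[OF f, of \<alpha>]]
  note P = W21_deriv_phase[OF S(1), of \<alpha>]
  show "W21_deriv (resolvent0 z \<alpha> f) (\<lambda>x. - \<i> * (f x + z * resolvent0 z \<alpha> f x))"
  proof (rule W21_deriv_cong_off_0[OF P(1)])
    fix x
    have "phase \<alpha> x * (cnj (phase \<alpha> x) * f x) = f x"
      by (simp only: mult.assoc[symmetric] phase_mult_cnj mult_1)
    then show "phase \<alpha> x * (- \<i> * (cnj (phase \<alpha> x) * f x + z * free_resolvent z (\<lambda>y. cnj (phase \<alpha> y) * f y) x))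
        = - \<i> * (f x + z * resolvent0 z \<alpha> f x)"
      unfolding resolvent0_def by (simp only: distrib_left mult.left_commute[of "phase \<alpha> x"])
  qed (simp add: resolvent0_def)
  show "bv_plus (resolvent0 z \<alpha> f) = exp (\<i> * of_real \<alpha>) * bv_minus (resolvent0 z \<alpha> f)"
    "bv_minus (resolvent0 z \<alpha> f) = free_resolvent z (\<lambda>y. cnj (phase \<alpha> y) * f y) 0"
    unfolding resolvent0_def[abs_def] P(2,3) S(2,3) by simp_all
qed

lemma E_1_W21_deriv:
  assumes z: "Im z \<noteq> 0"
  shows "W21_deriv (\<lambda>x. E v \<alpha> 1 x z) (\<lambda>x. - \<i> * (z * E v \<alpha> 1 x z))"
    "bv_plus (\<lambda>x. E v \<alpha> 1 x z) = exp (\<i> * of_real \<alpha>) * (if Im z < 0 then - \<i> else 0)"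
    "bv_minus (\<lambda>x. E v \<alpha> 1 x z) = (if Im z > 0 then \<i> else 0)"
proof -
  note g = W21_deriv_phase[OF gz_W21_deriv[OF z], of \<alpha>]
  show W: "W21_deriv (\<lambda>x. E v \<alpha> 1 x z) (\<lambda>x. - \<i> * (z * E v \<alpha> 1 x z))"
    by (rule W21_deriv_cong_off_0[OF g(1)]) (simp_all add: E_1_eq[OF z] del: One_nat_def)
  have eq: "\<forall>\<^sub>F x in F. phase \<alpha> x * gz z x = E v \<alpha> 1 x z" if "F \<le> at 0" for F
  proof (rule filter_leD[OF that])
    show "\<forall>\<^sub>F x in at 0. phase \<alpha> x * gz z x = E v \<alpha> 1 x z"
      unfolding eventually_at_filter by (rule always_eventually) (use E_1_eq[OF z] in metis)
  qed
  have "bv_plus (gz z) = (if Im z < 0 then - \<i> else 0)" "bv_minus (gz z) = (if Im z > 0 then \<i> else 0)"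
    by (intro bv_eqI gz_tendsto z)+
  with g(2,3) have b: "bv_plus (\<lambda>x. phase \<alpha> x * gz z x) = exp (\<i> * of_real \<alpha>) * (if Im z < 0 then - \<i> else 0)"
    "bv_minus (\<lambda>x. phase \<alpha> x * gz z x) = (if Im z > 0 then \<i> else 0)" by simp_all
  show "bv_plus (\<lambda>x. E v \<alpha> 1 x z) = exp (\<i> * of_real \<alpha>) * (if Im z < 0 then - \<i> else 0)"
    unfolding b(1)[symmetric]
    by (rule bv_eqI(1), rule Lim_transform_eventually[OF W21_deriv_tendsto(1)[OF g(1)] eq]) (simp add: at_le)
  show "bv_minus (\<lambda>x. E v \<alpha> 1 x z) = (if Im z > 0 then \<i> else 0)"
    unfolding b(2)[symmetric]
    by (rule bv_eqI(2), rule Lim_transform_eventually[OF W21_deriv_tendsto(2)[OF g(1)] eq]) (simp add: at_le)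
qed

text \<open>The left limit is integration against the free kernel at x = 0, that is
  \<open>gz z (- y)\<close>, which is the conjugate of \<open>gz (cnj z) y\<close> and hence, up to
  the phase, that of E_1 at the conjugate point.\<close>

lemma bv_minus_resolvent0:
  assumes z: "Im z \<noteq> 0" and f: "f \<in> L2"
  shows "bv_minus (resolvent0 z \<alpha> f) = inner_L2 f (\<lambda>x. E v \<alpha> 1 x (cnj z))"
proof -
  have cz: "Im (cnj z) \<noteq> 0" using z by simp
  have g: "cnj (gz (cnj z) y) = gz z (- y)" for y
    by (auto simp: gz_eq exp_cnj sgn_minus)
  show ?thesis
    unfolding resolvent0_W21_deriv(3)[OF z f] free_resolvent_def inner_L2_def
    by (rule LINT_cong_off_0) (simp add: E_1_eq[OF cz] g mult_ac del: One_nat_def)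
qed

subsection \<open>The perturbed operator\<close>

definition mean_bv :: "real \<Rightarrow> (real \<Rightarrow> complex) \<Rightarrow> complex" where
  "mean_bv \<alpha> \<psi> = bv_minus \<psi> / 2 + exp (- \<i> * of_real \<alpha>) / 2 * bv_plus \<psi>"

definition jump_bv :: "real \<Rightarrow> (real \<Rightarrow> complex) \<Rightarrow> complex" where
  "jump_bv \<alpha> \<psi> = \<i> * bv_minus \<psi> - \<i> * exp (- \<i> * of_real \<alpha>) * bv_plus \<psi>"

lemma mean_bv_add:
  "W21_deriv f d \<Longrightarrow> W21_deriv g e \<Longrightarrow> mean_bv \<alpha> (\<lambda>x. f x + g x) = mean_bv \<alpha> f + mean_bv \<alpha> g"
  by (simp add: mean_bv_def bv_add add_divide_distrib algebra_simps)

lemma jump_bv_add: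
  "W21_deriv f d \<Longrightarrow> W21_deriv g e \<Longrightarrow> jump_bv \<alpha> (\<lambda>x. f x + g x) = jump_bv \<alpha> f + jump_bv \<alpha> g"
  by (simp add: jump_bv_def bv_add algebra_simps)

lemma mean_bv_cmult: "W21_deriv f d \<Longrightarrow> mean_bv \<alpha> (\<lambda>x. c * f x) = c * mean_bv \<alpha> f"
  by (simp add: mean_bv_def bv_cmult algebra_simps)

lemma jump_bv_cmult: "W21_deriv f d \<Longrightarrow> jump_bv \<alpha> (\<lambda>x. c * f x) = c * jump_bv \<alpha> f"
  by (simp add: jump_bv_def bv_cmult algebra_simps)

lemma bv_cong_off_0:
  assumes "W21_deriv f d" "\<And>x. x \<noteq> 0 \<Longrightarrow> f x = g x"
  shows "bv_plus g = bv_plus f" "bv_minus g = bv_minus f"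
proof -
  have ev: "\<forall>\<^sub>F x in at 0 within S. f x = g x" for S
    unfolding eventually_at_filter using assms(2) by (intro always_eventually) auto
  show "bv_plus g = bv_plus f" "bv_minus g = bv_minus f"
    by (rule bv_eqI, rule Lim_transform_eventually[OF W21_deriv_tendsto(1)[OF assms(1)] ev])
       (rule bv_eqI, rule Lim_transform_eventually[OF W21_deriv_tendsto(2)[OF assms(1)] ev])
qed

lemma DomA_iff: "\<psi> \<in> DomA v \<alpha> \<longleftrightarrow> \<psi> \<in> W21_Omega \<and> jump_bv \<alpha> \<psi> = inner_L2 \<psi> v"
  unfolding DomA_def jump_bv_def by simp

lemma DomA_I: "W21_deriv \<psi> d \<Longrightarrow> jump_bv \<alpha> \<psi> = inner_L2 \<psi> v \<Longrightarrow> \<psi> \<in> DomA v \<alpha>"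
  unfolding DomA_iff W21_Omega_iff by blast

lemma DomA_W21_deriv: "\<psi> \<in> DomA v \<alpha> \<Longrightarrow> W21_deriv \<psi> (Wderiv \<psi>)"
  unfolding DomA_iff by (simp add: W21_deriv_Wderiv)

lemma DomA_L2: "\<psi> \<in> DomA v \<alpha> \<Longrightarrow> \<psi> \<in> L2"
  using DomA_W21_deriv W21_derivD(1) by blast

lemma opA_eq: "opA v \<alpha> \<psi> = (\<lambda>x. \<i> * Wderiv \<psi> x + mean_bv \<alpha> \<psi> * v x)"
  unfolding opA_def mean_bv_def by (simp add: mult.commute)

lemma opA_AE_eq:
  assumes "W21_deriv \<psi> d"
  shows "AE x in lborel. opA v \<alpha> \<psi> x = \<i> * d x + mean_bv \<alpha> \<psi> * v x"
  using AE_Wderiv[OF assms] unfolding opA_eq by auto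

lemma opA_L2: "v \<in> L2 \<Longrightarrow> \<psi> \<in> DomA v \<alpha> \<Longrightarrow> opA v \<alpha> \<psi> \<in> L2"
  unfolding opA_eq by (intro L2_add L2_cmult W21_derivD(2)[OF DomA_W21_deriv])

lemma exp_phase_mult [simp]:
  "exp (- (\<i> * complex_of_real a)) * exp (\<i> * complex_of_real a) = 1"
  "exp (\<i> * complex_of_real a) * exp (- (\<i> * complex_of_real a)) = 1"
  by (simp_all add: exp_add[symmetric])

lemma exp_phase_cancel [simp]:
  "exp (- (\<i> * complex_of_real a)) * (exp (\<i> * complex_of_real a) * w) = w"
  by (simp add: mult.assoc[symmetric])

text \<open>With p, q the left and phase-corrected right limits of psi, and p', q' those of phi,
  Green's boundary form is p cnj(p') - q cnj(q') = (p - q) cnj((p' + q') / 2) + ((p + q) / 2) cnj(p'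
  - q'): jump against mean. The boundary conditions express the jumps by inner products with v, and
  these cancel the contributions of the v term of A.\<close>

lemma opA_symmetric:
  assumes v: "v \<in> L2" and \<psi>: "\<psi> \<in> DomA v \<alpha>" and \<phi>: "\<phi> \<in> DomA v \<alpha>"
  shows "inner_L2 (opA v \<alpha> \<psi>) \<phi> = inner_L2 \<psi> (opA v \<alpha> \<phi>)"
proof -
  note W = DomA_W21_deriv[OF \<psi>] DomA_W21_deriv[OF \<phi>]
  note L = W[THEN W21_derivD(1)] W[THEN W21_derivD(2)] v
  define c where "c = exp (- \<i> * complex_of_real \<alpha>)"
  have c: "c * cnj c = 1" unfolding c_def by (simp add: exp_cnj)
  define p q p' q' where pq: "p = bv_minus \<psi>" "q = c * bv_plus \<psi>" "p' = bv_minus \<phi>" "q' = c * bv_plus \<phi>"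
  have m: "mean_bv \<alpha> \<psi> = (p + q) / 2" "mean_bv \<alpha> \<phi> = (p' + q') / 2"
    unfolding mean_bv_def pq c_def by (simp_all add: add_divide_distrib)
  have j: "inner_L2 \<psi> v = \<i> * (p - q)" "inner_L2 v \<phi> = cnj (\<i> * (p' - q'))"
    using \<psi> \<phi> inner_L2_commute[OF DomA_L2[OF \<phi>] v] unfolding DomA_iff jump_bv_def pq c_def
    by (simp_all add: algebra_simps)
  have "q * cnj q' = (c * cnj c) * (bv_plus \<psi> * cnj (bv_plus \<phi>))"
    unfolding pq by simp
  then have G: "inner_L2 (Wderiv \<psi>) \<phi> + inner_L2 \<psi> (Wderiv \<phi>) = p * cnj p' - q * cnj q'"
    using W21_deriv_Green[OF W] c by (simp add: pq)
  have "inner_L2 (opA v \<alpha> \<psi>) \<phi> - inner_L2 \<psi> (opA v \<alpha> \<phi>)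
      = \<i> * (inner_L2 (Wderiv \<psi>) \<phi> + inner_L2 \<psi> (Wderiv \<phi>))
        + mean_bv \<alpha> \<psi> * inner_L2 v \<phi> - cnj (mean_bv \<alpha> \<phi>) * inner_L2 \<psi> v"
    unfolding opA_eq
    by (simp add: inner_L2_add_left inner_L2_add_right inner_L2_cmult_left inner_L2_cmult_right L L2_cmult distrib_left)
  also have "\<dots> = 0"
    unfolding G m j by (simp add: field_simps)
  finally show ?thesis by simp
qed

lemma E_2_W21_deriv:
  assumes z: "Im z \<noteq> 0" and v: "v \<in> L2"
  shows "W21_deriv (\<lambda>x. E v \<alpha> 2 x z) (\<lambda>x. - \<i> * (v x + z * E v \<alpha> 2 x z))"
    "bv_plus (\<lambda>x. E v \<alpha> 2 x z) = bv_plus (resolvent0 z \<alpha> v)"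
    "bv_minus (\<lambda>x. E v \<alpha> 2 x z) = bv_minus (resolvent0 z \<alpha> v)"
proof -
  note R = resolvent0_W21_deriv(1)[OF z v, of \<alpha>]
  note eq = E_2_eq[OF z _ v, of _ \<alpha>, symmetric]
  show "W21_deriv (\<lambda>x. E v \<alpha> 2 x z) (\<lambda>x. - \<i> * (v x + z * E v \<alpha> 2 x z))"
    by (rule W21_deriv_cong_off_0[OF R]) (simp_all add: eq)
  show "bv_plus (\<lambda>x. E v \<alpha> 2 x z) = bv_plus (resolvent0 z \<alpha> v)"
    by (rule bv_cong_off_0(1)[OF R eq])
  show "bv_minus (\<lambda>x. E v \<alpha> 2 x z) = bv_minus (resolvent0 z \<alpha> v)"
    by (rule bv_cong_off_0(2)[OF R eq])
qed

lemma E_L2: "Im z \<noteq> 0 \<Longrightarrow> (\<lambda>x. E v \<alpha> 1 x z) \<in> L2" "Im z \<noteq> 0 \<Longrightarrow> v \<in> L2 \<Longrightarrow> (\<lambda>x. E v \<alpha> 2 x z) \<in> L2"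
  using E_1_W21_deriv(1) E_2_W21_deriv(1) W21_derivD(1) by blast+

lemma resolvent0_L2: "Im z \<noteq> 0 \<Longrightarrow> f \<in> L2 \<Longrightarrow> resolvent0 z \<alpha> f \<in> L2"
  using resolvent0_W21_deriv(1) W21_derivD(1) by blast

text \<open>E_1 is the only ingredient of the ansatz with a jump. Its one-sided limit vanishes on
  one side, so the mean is half of the other limit; this is the origin of \<gamma>_22.\<close>

lemma mean_jump_E_1:
  assumes z: "Im z \<noteq> 0"
  shows "mean_bv \<alpha> (\<lambda>x. E v \<alpha> 1 x z) = - gam v \<alpha> 2 2 z" "jump_bv \<alpha> (\<lambda>x. E v \<alpha> 1 x z) = - 1"
  using z unfolding mean_bv_def jump_bv_def E_1_W21_deriv(2,3)[OF z]
  by (auto simp: gam_def sgn_if mult.assoc)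

lemma mean_jump_resolvent0:
  assumes z: "Im z \<noteq> 0" and f: "f \<in> L2"
  shows "mean_bv \<alpha> (resolvent0 z \<alpha> f) = inner_L2 f (\<lambda>x. E v \<alpha> 1 x (cnj z))" "jump_bv \<alpha> (resolvent0 z \<alpha> f) = 0"
  using bv_minus_resolvent0[OF z f, of \<alpha> v] resolvent0_W21_deriv(2)[OF z f, of \<alpha>]
  by (simp_all add: mean_bv_def jump_bv_def mult.assoc[symmetric] del: One_nat_def)

lemma mean_jump_E_2:
  assumes z: "Im z \<noteq> 0" and v: "v \<in> L2"
  shows "mean_bv \<alpha> (\<lambda>x. E v \<alpha> 2 x z) = gam v \<alpha> 1 2 z - 1" "jump_bv \<alpha> (\<lambda>x. E v \<alpha> 2 x z) = 0"
  using mean_jump_resolvent0(1)[OF z v, of \<alpha> v] mean_jump_resolvent0(2)[OF z v, of \<alpha>]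
  unfolding mean_bv_def jump_bv_def E_2_W21_deriv(2,3)[OF z v] by (simp_all add: gam_def)

text \<open>Both functions satisfy the same unperturbed boundary condition, and exp(i \<alpha>) has
  modulus 1, so the boundary term in Green's identity vanishes; inserting the two resolvent
  equations leaves the claim.\<close>

lemma inner_resolvent0:
  assumes z: "Im z \<noteq> 0" and f: "f \<in> L2" and g: "g \<in> L2"
  shows "inner_L2 (resolvent0 z \<alpha> f) g = inner_L2 f (resolvent0 (cnj z) \<alpha> g)"
proof -
  have cz: "Im (cnj z) \<noteq> 0" using z by simp
  note F = resolvent0_W21_deriv[OF z f, of \<alpha>] and G = resolvent0_W21_deriv[OF cz g, of \<alpha>]
  let ?F = "resolvent0 z \<alpha> f" and ?G = "resolvent0 (cnj z) \<alpha> g"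
  note L = f g resolvent0_L2[OF z f, of \<alpha>] resolvent0_L2[OF cz g, of \<alpha>]
  have "(exp (\<i> * of_real \<alpha>) * cnj (exp (\<i> * of_real \<alpha>))) * (bv_minus ?F * cnj (bv_minus ?G)) = bv_minus ?F * cnj (bv_minus ?G)"
    by (simp add: exp_cnj)
  then have "bv_minus ?F * cnj (bv_minus ?G) - bv_plus ?F * cnj (bv_plus ?G) = 0"
    unfolding F(2) G(2) by (simp add: mult_ac)
  with W21_deriv_Green[OF F(1) G(1)]
  have "inner_L2 (\<lambda>x. - \<i> * (f x + z * ?F x)) ?G + inner_L2 ?F (\<lambda>x. - \<i> * (g x + cnj z * ?G x)) = 0"
    by simp
  then have "\<i> * (inner_L2 ?F g - inner_L2 f ?G) = 0"
    unfolding inner_L2_cmult_left inner_L2_cmult_right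
    by (simp add: inner_L2_add_left inner_L2_add_right inner_L2_cmult_left inner_L2_cmult_right L L2_cmult algebra_simps)
  then show ?thesis by simp
qed

text \<open>Moves the resolvent onto v, which produces the right-hand side of the second equation
  for the coefficients.\<close>

lemma inner_E_2:
  assumes z: "Im z \<noteq> 0" and v: "v \<in> L2" and f: "f \<in> L2"
  shows "inner_L2 (resolvent0 z \<alpha> f) v = inner_L2 f (\<lambda>x. E v \<alpha> 2 x (cnj z))"
proof -
  have cz: "Im (cnj z) \<noteq> 0" using z by simp
  show ?thesis
    unfolding inner_resolvent0[OF z f v] unfolding inner_L2_def
    by (rule LINT_cong_off_0) (simp add: E_2_eq[OF cz _ v])
qed

lemma gam_cnj:
  assumes z: "Im z \<noteq> 0" and v: "v \<in> L2" and jk: "j \<in> {1, 2}" "k \<in> {1, 2}"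
  shows "cnj (gam v \<alpha> k j (cnj z)) = gam v \<alpha> j k z"
proof -
  have cz: "Im (cnj z) \<noteq> 0" using z by simp
  have "inner_L2 (\<lambda>x. E v \<alpha> 2 x z) v = inner_L2 (resolvent0 z \<alpha> v) v"
    unfolding inner_L2_def by (rule LINT_cong_off_0) (simp add: E_2_eq[OF z _ v])
  also have "\<dots> = cnj (inner_L2 (\<lambda>x. E v \<alpha> 2 x (cnj z)) v)"
    unfolding inner_E_2[OF z v v] by (rule inner_L2_commute[OF E_L2(2)[OF cz v] v])
  finally have "cnj (gam v \<alpha> 1 1 (cnj z)) = gam v \<alpha> 1 1 z"
    by (simp add: gam_def)
  moreover have "cnj (gam v \<alpha> 1 2 (cnj z)) = gam v \<alpha> 2 1 z"
    using inner_L2_commute[OF v E_L2(1)[OF z, of v \<alpha>]] by (simp add: gam_def)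
  moreover have "cnj (gam v \<alpha> 2 1 (cnj z)) = gam v \<alpha> 1 2 z"
    using inner_L2_commute[OF E_L2(1)[OF cz, of v \<alpha>] v] by (simp add: gam_def)
  moreover have "cnj (gam v \<alpha> 2 2 (cnj z)) = gam v \<alpha> 2 2 z"
    by (simp add: gam_def sgn_minus)
  ultimately show ?thesis using jk by auto
qed

lemma gamma_det_cnj:
  assumes z: "Im z \<noteq> 0" and v: "v \<in> L2"
  shows "cnj (gamma_det v \<alpha> (cnj z)) = gamma_det v \<alpha> z"
  unfolding gamma_det_def complex_cnj_diff complex_cnj_mult
  by (simp add: gam_cnj[OF z v] mult.commute del: One_nat_def)

section \<open>Solving the resolvent equation\<close>

definition ansatz :: "(real \<Rightarrow> complex) \<Rightarrow> real \<Rightarrow> complex \<Rightarrow> (real \<Rightarrow> complex) \<Rightarrow> complex \<Rightarrow> complex \<Rightarrow> real \<Rightarrow> complex" where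
  "ansatz v \<alpha> z f c1 c2 x = resolvent0 z \<alpha> f x + (c1 * E v \<alpha> 1 x z + c2 * E v \<alpha> 2 x z)"

text \<open>Off the origin, \<open>\<i> u' - z u = f + c\<^sub>2 v\<close> for the ansatz \<open>u\<close>; the first equation on the
  coefficients makes the mean boundary value equal to \<open>- c\<^sub>2\<close>, the second one is the boundary
  condition.\<close>

lemma ansatz_solves:
  assumes z: "Im z \<noteq> 0" and v: "v \<in> L2" and f: "f \<in> L2"
    and c: "c1 * gam v \<alpha> 2 2 z - c2 * gam v \<alpha> 1 2 z = inner_L2 f (\<lambda>x. E v \<alpha> 1 x (cnj z))"
      "c2 * gam v \<alpha> 1 1 z - c1 * gam v \<alpha> 2 1 z = inner_L2 f (\<lambda>x. E v \<alpha> 2 x (cnj z))"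
  defines "u \<equiv> ansatz v \<alpha> z f c1 c2"
  shows "u \<in> DomA v \<alpha>" "mean_bv \<alpha> u = - c2" "AE x in lborel. opA v \<alpha> u x - z * u x = f x"
proof -
  note R = resolvent0_W21_deriv(1)[OF z f, of \<alpha>]
  note E1 = W21_deriv_cmult[OF E_1_W21_deriv(1)[OF z, of v \<alpha>], of c1]
  note E2 = W21_deriv_cmult[OF E_2_W21_deriv(1)[OF z v, of \<alpha>], of c2]
  note E12 = W21_deriv_add[OF E1 E2]
  have "W21_deriv u (\<lambda>x. - \<i> * (f x + z * resolvent0 z \<alpha> f x) + (c1 * (- \<i> * (z * E v \<alpha> 1 x z))
     + c2 * (- \<i> * (v x + z * E v \<alpha> 2 x z))))"
    unfolding u_def ansatz_def[abs_def] by (rule W21_deriv_add[OF R E12])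
  also have "(\<lambda>x. - \<i> * (f x + z * resolvent0 z \<alpha> f x) + (c1 * (- \<i> * (z * E v \<alpha> 1 x z))
     + c2 * (- \<i> * (v x + z * E v \<alpha> 2 x z)))) = (\<lambda>x. - \<i> * (f x + c2 * v x + z * u x))"
    unfolding u_def ansatz_def by (simp add: algebra_simps)
  finally have W: "W21_deriv u (\<lambda>x. - \<i> * (f x + c2 * v x + z * u x))" .
  note lin = mean_bv_add[OF R E12] mean_bv_add[OF E1 E2] jump_bv_add[OF R E12] jump_bv_add[OF E1 E2]
    mean_bv_cmult[OF E_1_W21_deriv(1)[OF z]] mean_bv_cmult[OF E_2_W21_deriv(1)[OF z v]]
    jump_bv_cmult[OF E_1_W21_deriv(1)[OF z]] jump_bv_cmult[OF E_2_W21_deriv(1)[OF z v]]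
    mean_jump_E_1[OF z] mean_jump_E_2[OF z v] mean_jump_resolvent0(1)[OF z f, of \<alpha> v] mean_jump_resolvent0(2)[OF z f, of \<alpha>]
  have "mean_bv \<alpha> u = inner_L2 f (\<lambda>x. E v \<alpha> 1 x (cnj z)) + (c1 * - gam v \<alpha> 2 2 z + c2 * (gam v \<alpha> 1 2 z - 1))"
    unfolding u_def ansatz_def[abs_def] lin ..
  then show mean: "mean_bv \<alpha> u = - c2"
    unfolding c(1)[symmetric] by (simp add: algebra_simps)
  have "inner_L2 u v = inner_L2 (resolvent0 z \<alpha> f) v + (c1 * inner_L2 (\<lambda>x. E v \<alpha> 1 x z) v + c2 * inner_L2 (\<lambda>x. E v \<alpha> 2 x z) v)"
    unfolding u_def ansatz_def[abs_def]
    using v W21_derivD(1)[OF R] W21_derivD(1)[OF E1] W21_derivD(1)[OF E2] W21_derivD(1)[OF E12]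
    by (simp only: inner_L2_add_left inner_L2_cmult_left)
  also have "\<dots> = - c1"
    unfolding inner_E_2[OF z v f] c(2)[symmetric] by (simp add: gam_def algebra_simps)
  finally have inn: "inner_L2 u v = - c1" .
  have jump: "jump_bv \<alpha> u = 0 + (c1 * - 1 + c2 * 0)"
    unfolding u_def ansatz_def[abs_def] lin ..
  show "u \<in> DomA v \<alpha>"
    by (rule DomA_I[OF W]) (simp add: jump inn)
  show "AE x in lborel. opA v \<alpha> u x - z * u x = f x"
    using opA_AE_eq[OF W, of v \<alpha>] by eventually_elim (simp add: mean algebra_simps)
qed

lemma DomA_diff:
  assumes v: "v \<in> L2" and \<psi>: "\<psi> \<in> DomA v \<alpha>" and \<phi>: "\<phi> \<in> DomA v \<alpha>"
  shows "(\<lambda>x. \<psi> x - \<phi> x) \<in> DomA v \<alpha>"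
    "AE x in lborel. opA v \<alpha> (\<lambda>x. \<psi> x - \<phi> x) x = opA v \<alpha> \<psi> x - opA v \<alpha> \<phi> x"
proof -
  note W = DomA_W21_deriv[OF \<psi>] W21_deriv_cmult[OF DomA_W21_deriv[OF \<phi>], of "-1"]
  have D: "W21_deriv (\<lambda>x. \<psi> x - \<phi> x) (\<lambda>x. Wderiv \<psi> x - Wderiv \<phi> x)"
    using W21_deriv_add[OF W] by simp
  have m: "mean_bv \<alpha> (\<lambda>x. \<psi> x - \<phi> x) = mean_bv \<alpha> \<psi> - mean_bv \<alpha> \<phi>"
    using mean_bv_add[OF W, of \<alpha>] mean_bv_cmult[OF DomA_W21_deriv[OF \<phi>], of \<alpha> "-1"] by simp
  have j: "jump_bv \<alpha> (\<lambda>x. \<psi> x - \<phi> x) = jump_bv \<alpha> \<psi> - jump_bv \<alpha> \<phi>"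
    using jump_bv_add[OF W, of \<alpha>] jump_bv_cmult[OF DomA_W21_deriv[OF \<phi>], of \<alpha> "-1"] by simp
  show "(\<lambda>x. \<psi> x - \<phi> x) \<in> DomA v \<alpha>"
    using \<psi> \<phi> unfolding DomA_iff[of \<psi>] DomA_iff[of \<phi>]
    by (intro DomA_I[OF D]) (simp add: j inner_L2_diff_left DomA_L2[OF \<psi>] DomA_L2[OF \<phi>] v)
  show "AE x in lborel. opA v \<alpha> (\<lambda>x. \<psi> x - \<phi> x) x = opA v \<alpha> \<psi> x - opA v \<alpha> \<phi> x"
    using opA_AE_eq[OF D, of v \<alpha>] by eventually_elim (simp add: m opA_eq algebra_simps)
qed

lemma opA_no_eigenvalue:
  assumes v: "v \<in> L2" and z: "Im z \<noteq> 0" and \<psi>: "\<psi> \<in> DomA v \<alpha>"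
    and eig: "AE x in lborel. opA v \<alpha> \<psi> x = z * \<psi> x"
  shows "AE x in lborel. \<psi> x = 0"
proof -
  note L = DomA_L2[OF \<psi>] opA_L2[OF v \<psi>]
  have "inner_L2 (opA v \<alpha> \<psi>) \<psi> = inner_L2 (\<lambda>x. z * \<psi> x) \<psi>"
    "inner_L2 \<psi> (opA v \<alpha> \<psi>) = inner_L2 \<psi> (\<lambda>x. z * \<psi> x)"
    using eig by (auto intro!: inner_L2_cong_AE L L2_cmult)
  then have "z * inner_L2 \<psi> \<psi> = cnj z * inner_L2 \<psi> \<psi>"
    using opA_symmetric[OF v \<psi> \<psi>] by (simp only: inner_L2_cmult_left inner_L2_cmult_right)
  moreover have "z \<noteq> cnj z" using z by (auto simp: complex_eq_iff)
  ultimately have "inner_L2 \<psi> \<psi> = 0" by simp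
  then show ?thesis using L2_AE_zero[OF L(1)] unfolding inner_L2_self by simp
qed

text \<open>A nonzero one-sided limit would keep f away from 0 on a whole interval, a set of
  positive measure.\<close>

lemma bv_AE_zero:
  assumes W: "W21_deriv f d" and 0: "AE x in lborel. f x = 0"
  shows "bv_plus f = 0" "bv_minus f = 0"
proof -
  have fr: "\<exists>x\<in>{a<..<b}. f x = 0" if "a < b" for a b
  proof (rule ccontr)
    assume "\<not> ?thesis"
    with 0 have "AE x in lborel. x \<notin> {a<..<b}" by (auto elim!: eventually_mono)
    then have "emeasure lborel {a<..<b} = 0"
      by (subst (asm) AE_iff_measurable[OF _ refl]) (auto simp: Collect_conj_eq greaterThanLessThan_def greaterThan_def lessThan_def)
    then show False using that by simp
  qed
  show "bv_plus f = 0"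
  proof (rule ccontr)
    assume "bv_plus f \<noteq> 0"
    from tendsto_imp_eventually_ne[OF W21_deriv_tendsto(1)[OF W] this]
    obtain b where "b > 0" "\<And>x. 0 < x \<Longrightarrow> x < b \<Longrightarrow> f x \<noteq> 0"
      unfolding eventually_at_right_field by blast
    with fr[of 0 b] show False by auto
  qed
  show "bv_minus f = 0"
  proof (rule ccontr)
    assume "bv_minus f \<noteq> 0"
    from tendsto_imp_eventually_ne[OF W21_deriv_tendsto(2)[OF W] this]
    obtain b where "b < 0" "\<And>x. b < x \<Longrightarrow> x < 0 \<Longrightarrow> f x \<noteq> 0"
      unfolding eventually_at_left_field by blast
    with fr[of b 0] show False by auto
  qed
qed

lemma gamma_det_nonzero:
  assumes z: "Im z \<noteq> 0" and v: "v \<in> L2"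
  shows "gamma_det v \<alpha> z \<noteq> 0"
proof
  assume g0: "gamma_det v \<alpha> z = 0"
  have g22: "gam v \<alpha> 2 2 z \<noteq> 0" using z by (simp add: gam_def sgn_if)
  \<comment> \<open>With f = 0 and second coefficient 1, this \<open>c\<close> solves the first
    equation, and the second then says that the determinant vanishes. The coefficient 1 gives
    \<open>u\<close> the mean boundary value -1, so \<open>u\<close> cannot vanish almost
    everywhere.\<close>
  define c where "c = gam v \<alpha> 1 2 z / gam v \<alpha> 2 2 z"
  define u where "u = ansatz v \<alpha> z (\<lambda>x. 0) c 1"
  have 0: "(\<lambda>x. 0) \<in> L2" "inner_L2 (\<lambda>x. 0) h = 0" for h
    by (simp_all add: L2_def inner_L2_def)
  have c: "c * gam v \<alpha> 2 2 z - 1 * gam v \<alpha> 1 2 z = 0" "1 * gam v \<alpha> 1 1 z - c * gam v \<alpha> 2 1 z = 0"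
    using g22 g0 unfolding c_def gamma_det_def by (simp_all add: field_simps)
  note u = ansatz_solves[OF z v 0(1), of c \<alpha> 1, unfolded 0(2), OF c, folded u_def]
  have "AE x in lborel. opA v \<alpha> u x = z * u x" using u(3) by simp
  from opA_no_eigenvalue[OF v z u(1) this] have "AE x in lborel. u x = 0" .
  from bv_AE_zero[OF DomA_W21_deriv[OF u(1)] this] have "mean_bv \<alpha> u = 0"
    by (simp add: mean_bv_def)
  with u(2) show False by simp
qed

lemma resolvent_exists:
  assumes z: "Im z \<noteq> 0" and v: "v \<in> L2" and f: "f \<in> L2"
  obtains u where "u \<in> DomA v \<alpha>" "AE x in lborel. opA v \<alpha> u x - z * u x = f x"
    "\<forall>x. x \<noteq> 0 \<longrightarrow> integrable lborel (\<lambda>y. Gv v \<alpha> z x y * f y)"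
    "\<forall>x. x \<noteq> 0 \<longrightarrow> u x = (LINT y|lborel. Gv v \<alpha> z x y * f y)"
proof -
  have cz: "Im (cnj z) \<noteq> 0" using z by simp
  let ?\<gamma> = "gamma_det v \<alpha> z" and ?g = "\<lambda>j k. gam v \<alpha> j k z"
  have \<gamma>: "?\<gamma> \<noteq> 0" by (rule gamma_det_nonzero[OF z v])
  define F where "F k = inner_L2 f (\<lambda>x. E v \<alpha> k x (cnj z))" for k
  \<comment> \<open>The system reads \<gamma>_22 c_1 - \<gamma>_12 c_2 = F_1 and -\<gamma>_21 c_1 +
    \<gamma>_11 c_2 = F_2; its matrix is the adjugate of \<Gamma>, with inverse \<Gamma> /
    \<gamma>.\<close>
  define c where "c j = (?g j 1 * F 1 + ?g j 2 * F 2) / ?\<gamma>" for j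
  define u where "u = ansatz v \<alpha> z f (c 1) (c 2)"
  have c1: "c 1 * ?g 2 2 - c 2 * ?g 1 2 = F 1"
  proof -
    have "c 1 * ?g 2 2 - c 2 * ?g 1 2 = (?\<gamma> * F 1) / ?\<gamma>"
      unfolding c_def gamma_det_def by (simp add: diff_divide_distrib[symmetric] algebra_simps)
    then show ?thesis using \<gamma> by simp
  qed
  have c2: "c 2 * ?g 1 1 - c 1 * ?g 2 1 = F 2"
  proof -
    have "c 2 * ?g 1 1 - c 1 * ?g 2 1 = (?\<gamma> * F 2) / ?\<gamma>"
      unfolding c_def gamma_det_def by (simp add: diff_divide_distrib[symmetric] algebra_simps)
    then show ?thesis using \<gamma> by simp
  qed
  note u = ansatz_solves[OF z v f c1[unfolded F_def] c2[unfolded F_def], folded F_def u_def]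
  have Ef: "integrable lborel (\<lambda>y. f y * cnj (E v \<alpha> 1 y (cnj z)))"
    "integrable lborel (\<lambda>y. f y * cnj (E v \<alpha> 2 y (cnj z)))"
    by (intro L2_inner_integrable f E_L2 v cz)+
  have G: "Gv v \<alpha> z x y * f y = G0 z x y \<alpha> * f y
      + ((E v \<alpha> 1 x z * ?g 1 1 + E v \<alpha> 2 x z * ?g 2 1) / ?\<gamma> * (f y * cnj (E v \<alpha> 1 y (cnj z)))
       + (E v \<alpha> 1 x z * ?g 1 2 + E v \<alpha> 2 x z * ?g 2 2) / ?\<gamma> * (f y * cnj (E v \<alpha> 2 y (cnj z))))" for x y
    unfolding Gv_def by (simp add: add_divide_distrib algebra_simps del: One_nat_def)
  show thesis
  proof (rule that[OF u(1,3)]; intro allI impI)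
    fix x :: real assume x: "x \<noteq> 0"
    note i = LINT_G0(1)[OF z x f, of \<alpha>] integrable_mult_right[OF Ef(1)] integrable_mult_right[OF Ef(2)]
    show "integrable lborel (\<lambda>y. Gv v \<alpha> z x y * f y)"
      unfolding G by (intro Bochner_Integration.integrable_add i)
    have "(LINT y|lborel. Gv v \<alpha> z x y * f y) = resolvent0 z \<alpha> f x
      + ((E v \<alpha> 1 x z * ?g 1 1 + E v \<alpha> 2 x z * ?g 2 1) / ?\<gamma> * F 1
       + (E v \<alpha> 1 x z * ?g 1 2 + E v \<alpha> 2 x z * ?g 2 2) / ?\<gamma> * F 2)"
      unfolding G F_def inner_L2_def
      by (simp only: Bochner_Integration.integral_add Bochner_Integration.integrable_add i
          LINT_G0(2)[OF z x f] integral_mult_right_zero)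
    also have "\<dots> = u x"
      unfolding u_def ansatz_def c_def by (simp add: add_divide_distrib algebra_simps del: One_nat_def)
    finally show "u x = (LINT y|lborel. Gv v \<alpha> z x y * f y)" ..
  qed
qed

text \<open>The kernel yields some solution with the same right-hand side; its difference from psi
  satisfies the eigenvalue equation at a nonreal point and so vanishes a.e.\<close>

lemma resolvent_unique:
  assumes z: "Im z \<noteq> 0" and v: "v \<in> L2" and \<psi>: "\<psi> \<in> DomA v \<alpha>"
  shows "AE x in lborel. \<psi> x = (LINT y|lborel. Gv v \<alpha> z x y * (opA v \<alpha> \<psi> y - z * \<psi> y))"
proof -
  have L: "(\<lambda>y. opA v \<alpha> \<psi> y - z * \<psi> y) \<in> L2"
    by (intro L2_diff L2_cmult opA_L2[OF v \<psi>] DomA_L2[OF \<psi>])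
  obtain u where u: "u \<in> DomA v \<alpha>"
    "AE x in lborel. opA v \<alpha> u x - z * u x = opA v \<alpha> \<psi> x - z * \<psi> x"
    "\<forall>x. x \<noteq> 0 \<longrightarrow> u x = (LINT y|lborel. Gv v \<alpha> z x y * (opA v \<alpha> \<psi> y - z * \<psi> y))"
    by (rule resolvent_exists[OF z v L, of \<alpha>])
  note D = DomA_diff[OF v \<psi> u(1)]
  have "AE x in lborel. opA v \<alpha> (\<lambda>x. \<psi> x - u x) x = z * (\<psi> x - u x)"
    using D(2) u(2)
  proof eventually_elim
    case (elim x)
    have "opA v \<alpha> \<psi> x - opA v \<alpha> u x = z * \<psi> x - z * u x"
      using arg_cong[OF elim(2), of "\<lambda>w. opA v \<alpha> \<psi> x - z * u x - w"] by simp
    with elim(1) show ?case by (simp add: right_diff_distrib)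
  qed
  from opA_no_eigenvalue[OF v z D(1) this] AE_not_0
  show ?thesis by eventually_elim (simp add: u(3))
qed

section \<open>Density of the domain and self-adjointness\<close>

lemma DomA_dense:
  assumes v: "v \<in> L2" and f: "f \<in> L2" and e: "e > 0"
  shows "\<exists>\<psi>\<in>DomA v \<alpha>. (LINT x|lborel. (cmod (f x - \<psi> x))\<^sup>2) < e"
proof -
  from e have "e / 4 > 0" by simp
  then obtain \<psi> d where \<psi>: "W21_deriv \<psi> d" "(LINT x|lborel. (cmod (f x - \<psi> x))\<^sup>2) < e / 4"
    by (rule W21_dense[OF f])
  \<comment> \<open>The amount by which the approximant violates the boundary condition.\<close>
  define a where "a = jump_bv \<alpha> \<psi> - inner_L2 \<psi> v"
  define V where "V = (LINT x|lborel. (cmod (v x))\<^sup>2)"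
  have V: "V \<ge> 0" unfolding V_def by simp
  define t where "t = 1 / (2 * (V + 1))"
  have t: "t > 0" "t * V \<le> 1 / 2" using V unfolding t_def by (simp_all add: field_simps)
  \<comment> \<open>The summand 1 keeps n positive, the second one keeps |<g_z, v>| at most 1/2, and
    the third keeps the squared norm of the correction at most e / 4. The weight t was chosen with t
    V at most 1/2, so that the v part of the AM-GM bound is at most 1/4.\<close>
  define n where "n = 1 + 1 / t\<^sup>2 + 8 * (cmod a)\<^sup>2 / e"
  have n: "n > 0" unfolding n_def using t e by (simp add: add_pos_nonneg)
  define z where "z = Complex 0 n"
  have z: "Im z \<noteq> 0" "\<bar>Im z\<bar> = n" using n unfolding z_def by auto
  note g = gz_W21_deriv[OF z(1)]
  note gL = gz_L2[OF z(1)]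
  have ng: "(LINT x|lborel. (cmod (gz z x))\<^sup>2) = 1 / (2 * n)"
    using LINT_gz_square[OF z(1)] z(2) by simp
  have "bv_plus (gz z) = 0" "bv_minus (gz z) = \<i>"
    using bv_eqI(1)[OF gz_tendsto(1)[OF z(1)]] bv_eqI(2)[OF gz_tendsto(2)[OF z(1)]] n by (simp_all add: z_def)
  then have jg: "jump_bv \<alpha> (gz z) = - 1" unfolding jump_bv_def by simp
  \<comment> \<open>The violation caused by g_z itself. It stays at least 1/2 in modulus, so the
    solution c of a + c b = 0 obeys |c| at most 2 |a|, independently of n.\<close>
  define b where "b = - 1 - inner_L2 (gz z) v"
  have "cmod (inner_L2 (gz z) v) \<le> 1 / 2"
  proof -
    have "cmod (inner_L2 (gz z) v) \<le> (1 / t * (1 / (2 * n)) + V / (1 / t)) / 2"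
      using inner_L2_le[OF gL v, of "1 / t"] t unfolding ng V_def by simp
    moreover have "1 / t * (1 / (2 * n)) \<le> 1 / 2"
    proof -
      have "t \<le> 1 / 2" using V unfolding t_def by (simp add: field_simps)
      then have "1 / t \<le> 1 / t\<^sup>2" using t by (simp add: field_simps power2_eq_square)
      also have "\<dots> \<le> n" unfolding n_def using e by (simp add: add_nonneg_nonneg)
      finally show ?thesis using n t(1) by (simp add: field_simps)
    qed
    ultimately show ?thesis using t by (simp add: field_simps)
  qed
  moreover have "cmod (- 1) \<le> cmod b + cmod (inner_L2 (gz z) v)"
    unfolding b_def using norm_triangle_ineq[of "- 1 - inner_L2 (gz z) v" "inner_L2 (gz z) v"] by simp
  ultimately have b: "cmod b \<ge> 1 / 2" by simp
  define c where "c = - a / b"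
  have b0: "b \<noteq> 0" using b by auto
  have "cmod c \<le> 2 * cmod a"
    unfolding c_def using b b0 by (simp add: norm_divide divide_le_eq mult_left_le_one_le mult_le_cancel_left1 field_simps)
  then have c2: "(cmod c)\<^sup>2 \<le> 4 * (cmod a)\<^sup>2"
    using power_mono[of "cmod c" "2 * cmod a" 2] by (simp add: power_mult_distrib)
  define \<phi> where "\<phi> x = \<psi> x + c * gz z x" for x
  note cg = W21_deriv_cmult[OF g, of c]
  have W: "W21_deriv \<phi> (\<lambda>x. d x + c * (- \<i> * (z * gz z x)))"
    unfolding \<phi>_def[abs_def] by (rule W21_deriv_add[OF \<psi>(1) cg])
  have "\<phi> \<in> DomA v \<alpha>"
  proof (rule DomA_I[OF W])
    have "jump_bv \<alpha> \<phi> = jump_bv \<alpha> \<psi> - c"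
      unfolding \<phi>_def[abs_def] by (simp add: jump_bv_add[OF \<psi>(1) cg] jump_bv_cmult[OF g] jg)
    moreover have "inner_L2 \<phi> v = inner_L2 \<psi> v + c * inner_L2 (gz z) v"
      unfolding \<phi>_def[abs_def]
      by (simp add: inner_L2_add_left inner_L2_cmult_left W21_derivD(1)[OF \<psi>(1)] gL L2_cmult v)
    moreover have "a + c * b = 0" unfolding c_def using b0 by simp
    ultimately show "jump_bv \<alpha> \<phi> = inner_L2 \<phi> v"
      unfolding a_def b_def by (simp add: algebra_simps)
  qed
  moreover have "(LINT x|lborel. (cmod (f x - \<phi> x))\<^sup>2) < e"
  proof -
    have "(LINT x|lborel. (cmod (\<psi> x - \<phi> x))\<^sup>2) = (cmod c)\<^sup>2 * (1 / (2 * n))"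
      unfolding \<phi>_def by (simp add: norm_mult power_mult_distrib ng)
    also have "\<dots> \<le> 4 * (cmod a)\<^sup>2 * (1 / (2 * n))"
      using c2 n by (intro mult_right_mono) auto
    also have "\<dots> = 2 * (cmod a)\<^sup>2 / n" using n by (simp add: field_simps)
    also have "\<dots> \<le> e / 4"
    proof -
      have "8 * (cmod a)\<^sup>2 / e \<le> n" unfolding n_def using t by (simp add: add_nonneg_nonneg)
      then show ?thesis using n e by (simp add: field_simps)
    qed
    finally show ?thesis
      using L2_dist_triangle[OF f W21_derivD(1)[OF \<psi>(1)] W21_derivD(1)[OF W]] \<psi>(2) by linarith
  qed
  ultimately show ?thesis by blast
qed

text \<open>The candidate \<phi>' solves (A - i) \<phi>' = \<eta> - i \<phi>. By symmetry and the
  adjoint relation, \<phi> - \<phi>' is orthogonal to the range of A + i; since that range reaches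
  \<phi> - \<phi>' itself, the difference has norm zero.\<close>

lemma opA_adjoint:
  assumes v: "v \<in> L2" and \<phi>: "\<phi> \<in> L2" and \<eta>: "\<eta> \<in> L2"
    and adj: "\<And>\<psi>. \<psi> \<in> DomA v \<alpha> \<Longrightarrow> inner_L2 (opA v \<alpha> \<psi>) \<phi> = inner_L2 \<psi> \<eta>"
  obtains \<phi>' where "\<phi>' \<in> DomA v \<alpha>" "AE x in lborel. \<phi> x = \<phi>' x" "AE x in lborel. \<eta> x = opA v \<alpha> \<phi>' x"
proof -
  have "Im \<i> \<noteq> 0" "Im (- \<i>) \<noteq> 0" by simp_all
  have L0: "(\<lambda>x. \<eta> x - \<i> * \<phi> x) \<in> L2" by (intro L2_diff L2_cmult \<phi> \<eta>)
  obtain \<phi>' where \<phi>': "\<phi>' \<in> DomA v \<alpha>" "AE x in lborel. opA v \<alpha> \<phi>' x - \<i> * \<phi>' x = \<eta> x - \<i> * \<phi> x"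
    by (rule resolvent_exists[OF \<open>Im \<i> \<noteq> 0\<close> v L0])
  note \<phi>'L = DomA_L2[OF \<phi>'(1)] opA_L2[OF v \<phi>'(1)]
  have diff: "(\<lambda>x. \<phi> x - \<phi>' x) \<in> L2" by (intro L2_diff \<phi> \<phi>'L)
  obtain \<psi> where \<psi>: "\<psi> \<in> DomA v \<alpha>" "AE x in lborel. opA v \<alpha> \<psi> x - - \<i> * \<psi> x = \<phi> x - \<phi>' x"
    by (rule resolvent_exists[OF \<open>Im (- \<i>) \<noteq> 0\<close> v diff])
  note \<psi>L = DomA_L2[OF \<psi>(1)] opA_L2[OF v \<psi>(1)]
  note L = \<phi> \<eta> \<phi>'L \<psi>L
  have "inner_L2 (\<lambda>x. \<phi> x - \<phi>' x) (\<lambda>x. \<phi> x - \<phi>' x) = inner_L2 (\<lambda>x. opA v \<alpha> \<psi> x - - \<i> * \<psi> x) (\<lambda>x. \<phi> x - \<phi>' x)"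
    using \<psi>(2) by (intro inner_L2_cong_AE L2_diff L2_cmult L) auto
  also have "\<dots> = inner_L2 \<psi> (\<lambda>x. \<eta> x - \<i> * \<phi> x) - inner_L2 \<psi> (\<lambda>x. opA v \<alpha> \<phi>' x - \<i> * \<phi>' x)"
    using adj[OF \<psi>(1)] opA_symmetric[OF v \<psi>(1) \<phi>'(1)]
    by (simp add: inner_L2_diff_left inner_L2_diff_right inner_L2_add_left inner_L2_cmult_left inner_L2_cmult_right L L2_diff L2_cmult algebra_simps)
  also have "inner_L2 \<psi> (\<lambda>x. opA v \<alpha> \<phi>' x - \<i> * \<phi>' x) = inner_L2 \<psi> (\<lambda>x. \<eta> x - \<i> * \<phi> x)"
    using \<phi>'(2) by (intro inner_L2_cong_AE L2_diff L2_cmult L) auto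
  finally have "inner_L2 (\<lambda>x. \<phi> x - \<phi>' x) (\<lambda>x. \<phi> x - \<phi>' x) = 0" by simp
  then have "AE x in lborel. \<phi> x - \<phi>' x = 0"
    using L2_AE_zero[OF diff] unfolding inner_L2_self by simp
  then have eq: "AE x in lborel. \<phi> x = \<phi>' x" by simp
  moreover have "AE x in lborel. \<eta> x = opA v \<alpha> \<phi>' x"
    using eq \<phi>'(2) by eventually_elim simp
  ultimately show ?thesis by (rule that[OF \<phi>'(1)])
qed

lemma opA_self_adjoint:
  assumes v: "v \<in> L2"
  shows "self_adjoint_L2 (DomA v \<alpha>) (opA v \<alpha>)"
  unfolding self_adjoint_L2_def
proof (intro conjI ballI allI impI iffI)
  show "DomA v \<alpha> \<subseteq> L2" using DomA_L2 by blast
  show "opA v \<alpha> \<psi> \<in> L2" if "\<psi> \<in> DomA v \<alpha>" for \<psi> by (rule opA_L2[OF v that])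
  show "\<exists>\<psi>\<in>DomA v \<alpha>. (LINT x|lborel. (cmod (f x - \<psi> x))\<^sup>2) < e" if "f \<in> L2" "e > 0" for f e
    by (rule DomA_dense[OF v that])
next
  fix \<phi> \<eta> assume L: "\<phi> \<in> L2" "\<eta> \<in> L2"
  show "\<exists>\<phi>'\<in>DomA v \<alpha>. (AE x in lborel. \<phi> x = \<phi>' x) \<and> (AE x in lborel. \<eta> x = opA v \<alpha> \<phi>' x)"
    if adj: "\<forall>\<psi>\<in>DomA v \<alpha>. inner_L2 (opA v \<alpha> \<psi>) \<phi> = inner_L2 \<psi> \<eta>"
  proof -
    obtain \<phi>' where "\<phi>' \<in> DomA v \<alpha>" "AE x in lborel. \<phi> x = \<phi>' x" "AE x in lborel. \<eta> x = opA v \<alpha> \<phi>' x"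
      by (rule opA_adjoint[OF v L bspec[OF adj]])
    then show ?thesis by blast
  qed
  show "inner_L2 (opA v \<alpha> \<psi>) \<phi> = inner_L2 \<psi> \<eta>" if \<psi>: "\<psi> \<in> DomA v \<alpha>"
    and ex: "\<exists>\<phi>'\<in>DomA v \<alpha>. (AE x in lborel. \<phi> x = \<phi>' x) \<and> (AE x in lborel. \<eta> x = opA v \<alpha> \<phi>' x)" for \<psi>
  proof -
    from ex obtain \<phi>' where \<phi>': "\<phi>' \<in> DomA v \<alpha>" "AE x in lborel. \<phi> x = \<phi>' x" "AE x in lborel. \<eta> x = opA v \<alpha> \<phi>' x"
      by blast
    have "inner_L2 (opA v \<alpha> \<psi>) \<phi> = inner_L2 (opA v \<alpha> \<psi>) \<phi>'"
      by (intro inner_L2_cong_AE opA_L2 v \<psi> L DomA_L2[OF \<phi>'(1)] \<phi>'(2)) simp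
    also have "\<dots> = inner_L2 \<psi> (opA v \<alpha> \<phi>')" by (rule opA_symmetric[OF v \<psi> \<phi>'(1)])
    also have "\<dots> = inner_L2 \<psi> \<eta>"
      using \<phi>'(3) by (intro inner_L2_cong_AE opA_L2 v \<phi>'(1) L DomA_L2[OF \<psi>]) auto
    finally show ?thesis .
  qed
qed

theorem theorem3p2:
  fixes v :: "real \<Rightarrow> complex" and \<alpha> :: real
  assumes "v \<in> L2"
  shows "self_adjoint_L2 (DomA v \<alpha>) (opA v \<alpha>) \<and>
    (\<forall>z. Im z \<noteq> 0 \<longrightarrow>
       (\<forall>f\<in>L2. (AE x in lborel. integrable lborel (\<lambda>y. Gv v \<alpha> z x y * f y)) \<and>
          (\<exists>u\<in>DomA v \<alpha>.
             (AE x in lborel. u x = (LINT y|lborel. Gv v \<alpha> z x y * f y)) \<and>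
             (AE x in lborel. opA v \<alpha> u x - z * u x = f x))) \<and>
       (\<forall>\<psi>\<in>DomA v \<alpha>. AE x in lborel.
          \<psi> x = (LINT y|lborel. Gv v \<alpha> z x y * (opA v \<alpha> \<psi> y - z * \<psi> y))) \<and>
       (\<forall>j\<in>{1,2}. \<forall>k\<in>{1,2}. cnj (gam v \<alpha> k j (cnj z)) = gam v \<alpha> j k z) \<and>
       cnj (gamma_det v \<alpha> (cnj z)) = gamma_det v \<alpha> z \<and>
       gamma_det v \<alpha> z \<noteq> 0)"
proof (intro conjI allI impI ballI)
  note v = assms
  show "self_adjoint_L2 (DomA v \<alpha>) (opA v \<alpha>)" by (rule opA_self_adjoint[OF v])
  fix z :: complex assume z: "Im z \<noteq> 0"
  show "cnj (gamma_det v \<alpha> (cnj z)) = gamma_det v \<alpha> z" by (rule gamma_det_cnj[OF z v])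
  show "gamma_det v \<alpha> z \<noteq> 0" by (rule gamma_det_nonzero[OF z v])
  show "cnj (gam v \<alpha> k j (cnj z)) = gam v \<alpha> j k z" if "j \<in> {1,2}" "k \<in> {1,2}" for j k
    by (rule gam_cnj[OF z v that])
  show "AE x in lborel. \<psi> x = (LINT y|lborel. Gv v \<alpha> z x y * (opA v \<alpha> \<psi> y - z * \<psi> y))"
    if "\<psi> \<in> DomA v \<alpha>" for \<psi>
    by (rule resolvent_unique[OF z v that])
  fix f assume f: "f \<in> L2"
  obtain u where u: "u \<in> DomA v \<alpha>"
    "AE x in lborel. opA v \<alpha> u x - z * u x = f x"
    "\<forall>x. x \<noteq> 0 \<longrightarrow> integrable lborel (\<lambda>y. Gv v \<alpha> z x y * f y)"
    "\<forall>x. x \<noteq> 0 \<longrightarrow> u x = (LINT y|lborel. Gv v \<alpha> z x y * f y)"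
    by (rule resolvent_exists[OF z v f])
  show "AE x in lborel. integrable lborel (\<lambda>y. Gv v \<alpha> z x y * f y)"
    using u(3) by (intro AE_off_0) blast
  show "\<exists>u\<in>DomA v \<alpha>. (AE x in lborel. u x = (LINT y|lborel. Gv v \<alpha> z x y * f y)) \<and>
      (AE x in lborel. opA v \<alpha> u x - z * u x = f x)"
    proof (intro bexI conjI)
    show "AE x in lborel. u x = (LINT y|lborel. Gv v \<alpha> z x y * f y)"
      using u(4) by (intro AE_off_0) blast
  qed (rule u)+
qed

end
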